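(* Let $d\geq 1$ and let $G=(V,E)$ be a finite simple graph that is vertex-redundantly rigid in $\mathbb{R}^d$, i.e. $G-v$ is rigid in $\mathbb{R}^d$ for every $v\in V$. Then $G$ is globally rigid in $\mathbb{R}^d$.
   Context: A framework $(G,\mathbf{p})$ in $\mathbb{R}^d$ is a graph $G=(V,E)$ with a map $\mathbf{p}:V\to\mathbb{R}^d$. Two frameworks $(G,\mathbf{p}),(G,\mathbf{q})$ are equivalent if $\|p_u-p_v\|=\|q_u-q_v\|$ for all $uv\in E$; $\mathbf{p},\mathbf{q}$ are congruent if this holds for all pairs $u,v\in V$. $(G,\mathbf{p})$ is rigid if there is a neighbourhood $U$ of $\mathbf{p}$ in $\mathbb{R}^{d|V|}$ such that every $\mathbf{q}\in U$ with $(G,\mathbf{q})$ equivalent to $(G,\mathbf{p})$ is congruent to $\mathbf{p}$; globally rigid if every $\mathbf{q}\in\mathbb{R}^{d|V|}$ with $(G,\mathbf{q})$ equivalent to $(G,\mathbf{p})$ is congruent to $\mathbf{p}$. $\mathbf{p}$ is generic if its coordinates are algebraically independent over $\mathbb{Q}$. A graph is rigid (resp. globally rigid) in $\mathbb{R}^d$ if some (equivalently every) generic realization is rigid (resp. globally rigid).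
   Formalization: The graph with exactly two vertices and no edges is excluded: deleting either vertex leaves a single vertex, which is rigid in every dimension, but the graph itself is not globally rigid, so the claim as worded fails for it. *)

theory Defs
  imports "HOL-Analysis.Analysis" "HOL-Library.Poly_Mapping"
begin

definition simple_graph :: "'a set \<Rightarrow> 'a set set \<Rightarrow> bool" where
  "simple_graph V E \<longleftrightarrow> finite V \<and> (\<forall>e\<in>E. e \<subseteq> V \<and> card e = 2)"

definition del_edges :: "'a set set \<Rightarrow> 'a \<Rightarrow> 'a set set" where
  "del_edges E v = {e \<in> E. v \<notin> e}"

text \<open>The type \<open>('i \<Rightarrow>\<^sub>0 nat) \<Rightarrow>\<^sub>0 rat\<close> of finitely supported functions from monomials
  (finitely supported exponent vectors) to coefficients is the polynomial ring over the
  rationals in indeterminates indexed by \<open>'i\<close>.\<close>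

definition poly_eval :: "('i \<Rightarrow> real) \<Rightarrow> (('i \<Rightarrow>\<^sub>0 nat) \<Rightarrow>\<^sub>0 rat) \<Rightarrow> real" where
  "poly_eval x P =
     (\<Sum>m\<in>Poly_Mapping.keys P. of_rat (Poly_Mapping.lookup P m) *
        (\<Prod>i\<in>Poly_Mapping.keys m. x i ^ Poly_Mapping.lookup m i))"

definition alg_independent_rat :: "'i set \<Rightarrow> ('i \<Rightarrow> real) \<Rightarrow> bool" where
  "alg_independent_rat I x \<longleftrightarrow>
     (\<forall>P. (\<forall>m\<in>Poly_Mapping.keys P. Poly_Mapping.keys m \<subseteq> I) \<longrightarrow> poly_eval x P = 0 \<longrightarrow> P = 0)"

text \<open>Euclidean \<open>d\<close>-space is \<open>real ^ 'd\<close> with \<open>d = CARD('d) \<ge> 1\<close>. A realization of a graph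
  with vertex set \<open>V\<close> is an extensional function on \<open>V\<close>, so that the space of realizations
  is the product of \<open>V\<close> copies of \<open>real ^ 'd\<close>.\<close>

abbreviation realizations :: "'a set \<Rightarrow> ('a \<Rightarrow> real ^ 'd) set" where
  "realizations V \<equiv> V \<rightarrow>\<^sub>E UNIV"

abbreviation realization_topology :: "'a set \<Rightarrow> ('a \<Rightarrow> real ^ 'd) topology" where
  "realization_topology V \<equiv> product_topology (\<lambda>_. euclidean) V"

definition equivalent_fw ::
    "'a set set \<Rightarrow> ('a \<Rightarrow> real ^ 'd) \<Rightarrow> ('a \<Rightarrow> real ^ 'd) \<Rightarrow> bool" where
  "equivalent_fw E p q \<longleftrightarrow>
     (\<forall>u v. {u, v} \<in> E \<longrightarrow> norm (p u - p v) = norm (q u - q v))"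

definition congruent_fw ::
    "'a set \<Rightarrow> ('a \<Rightarrow> real ^ 'd) \<Rightarrow> ('a \<Rightarrow> real ^ 'd) \<Rightarrow> bool" where
  "congruent_fw V p q \<longleftrightarrow>
     (\<forall>u\<in>V. \<forall>v\<in>V. norm (p u - p v) = norm (q u - q v))"

definition rigid_fw :: "'a set \<Rightarrow> 'a set set \<Rightarrow> ('a \<Rightarrow> real ^ 'd) \<Rightarrow> bool" where
  "rigid_fw V E p \<longleftrightarrow>
     (\<exists>U. openin (realization_topology V) U \<and> p \<in> U \<and>
        (\<forall>q\<in>U. equivalent_fw E p q \<longrightarrow> congruent_fw V p q))"

definition globally_rigid_fw :: "'a set \<Rightarrow> 'a set set \<Rightarrow> ('a \<Rightarrow> real ^ 'd) \<Rightarrow> bool" where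
  "globally_rigid_fw V E p \<longleftrightarrow>
     (\<forall>q\<in>realizations V. equivalent_fw E p q \<longrightarrow> congruent_fw V p q)"

definition generic :: "'a set \<Rightarrow> ('a \<Rightarrow> real ^ 'd) \<Rightarrow> bool" where
  "generic V p \<longleftrightarrow> alg_independent_rat (V \<times> UNIV) (\<lambda>(v, i). p v $ i)"

text \<open>The \<open>'d itself\<close> argument supplies the dimension, which does not occur in the type of
  the graph.\<close>

definition rigid_graph :: "'d::finite itself \<Rightarrow> 'a set \<Rightarrow> 'a set set \<Rightarrow> bool" where
  "rigid_graph _ V E \<longleftrightarrow>
     (\<exists>p :: 'a \<Rightarrow> real ^ 'd. p \<in> realizations V \<and> generic V p \<and> rigid_fw V E p)"

definition globally_rigid_graph :: "'d::finite itself \<Rightarrow> 'a set \<Rightarrow> 'a set set \<Rightarrow> bool" where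
  "globally_rigid_graph _ V E \<longleftrightarrow>
     (\<exists>p :: 'a \<Rightarrow> real ^ 'd. p \<in> realizations V \<and> generic V p \<and> globally_rigid_fw V E p)"

text \<open>A graph consisting of two isolated vertices satisfies this condition in every dimension,
  since both vertex deletions leave a single vertex, but it is not globally rigid.\<close>

definition vertex_redundantly_rigid :: "'d::finite itself \<Rightarrow> 'a set \<Rightarrow> 'a set set \<Rightarrow> bool" where
  "vertex_redundantly_rigid D V E \<longleftrightarrow> (\<forall>v\<in>V. rigid_graph D (V - {v}) (del_edges E v))"

end

theory Submission
  imports Defs "HOL-Computational_Algebra.Polynomial"
begin

text \<open>
  The coordinates of a generic realization \<open>p\<close> are algebraically independent, so a derivation of the
  field of real numbers can take arbitrary values on them. Applied to the equal edge lengths of \<open>p\<close>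
  and an equivalent realization \<open>q\<close>, derivations turn stresses of \<open>q\<close> into stresses of \<open>p\<close>; hence
  infinitesimal rigidity passes from \<open>p\<close> to \<open>q\<close>, and a derivation that vanishes on \<open>p\<close> vanishes on
  all distances of \<open>q\<close>.

  Let \<open>G\<close> be vertex-redundantly rigid and not complete. A vertex \<open>v\<close> that is not adjacent to all
  others has degree at least \<open>d + 1\<close>. Derivations that vanish on \<open>p\<close> outside \<open>v\<close> but are arbitrary on
  \<open>p v\<close> show that the equations \<open>|p v - p u| = |q v - q u|\<close> for the neighbours \<open>u\<close> of \<open>v\<close> force \<open>p\<close>
  and \<open>q\<close> to be congruent on these neighbours. So \<open>p\<close> and \<open>q\<close> are equivalent on the graph \<open>G'\<close>
  obtained from \<open>G - v\<close> by joining all neighbours of \<open>v\<close>. This graph is again vertex-redundantly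
  rigid, and induction on the number of vertices gives congruence.
\<close>

section \<open>Polynomial functions of a generic realization\<close>

text \<open>Nothing is known about \<open>q\<close> beyond its edge lengths: it need not be generic,
  and its coordinates may be transcendental over those of \<open>p\<close>. Derivations of all of
  \<real> are insensitive to this, since equal squared lengths have equal derivatives and a
  derivation acts on both realizations as an infinitesimal motion. The freedom to prescribe
  derivations comes from \<open>p\<close> alone.

  The argument is linear and takes place at one fixed pair \<open>p\<close>, \<open>q\<close>,
  whereas rigidity is given topologically and for some generic realization. Hence the hypothesis is
  converted into infinitesimal rigidity of \<open>p\<close> on every \<open>V - {v}\<close>, and the
  induction carries only that.

  The congruence of neighbours rests on two facts. Relative to a simplex of d + 1 neighbours,
  \<open>p v\<close> and \<open>q v\<close> have the same coefficients \<open>s\<close>;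
  differentiating the equality of squared lengths at \<open>v\<close> forces this. And some
  derivation annihilates all dot products of the simplex edges while moving a single coefficient;
  applied to one length equation, it isolates the squared length of one simplex edge.\<close>

definition monom_eval :: "('i \<Rightarrow> real) \<Rightarrow> ('i \<Rightarrow>\<^sub>0 nat) \<Rightarrow> real" where
  "monom_eval x m = (\<Prod>i\<in>Poly_Mapping.keys m. x i ^ Poly_Mapping.lookup m i)"

lemma monom_eval_superset:
  assumes "finite A" "Poly_Mapping.keys m \<subseteq> A"
  shows "monom_eval x m = (\<Prod>i\<in>A. x i ^ Poly_Mapping.lookup m i)"
  unfolding monom_eval_def
  by (rule prod.mono_neutral_left) (use assms in \<open>auto simp: in_keys_iff\<close>)

lemma monom_eval_add: "monom_eval x (m + n) = monom_eval x m * monom_eval x n"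
proof -
  let ?A = "Poly_Mapping.keys m \<union> Poly_Mapping.keys n"
  have "Poly_Mapping.keys (m + n) \<subseteq> ?A" by (rule Poly_Mapping.keys_add)
  then show ?thesis
    by (simp add: monom_eval_superset[of ?A] lookup_add power_add prod.distrib)
qed

lemma poly_eval_superset:
  assumes "finite A" "Poly_Mapping.keys P \<subseteq> A"
  shows "poly_eval x P = (\<Sum>m\<in>A. of_rat (Poly_Mapping.lookup P m) * monom_eval x m)"
  unfolding poly_eval_def monom_eval_def[symmetric]
  by (rule sum.mono_neutral_left) (use assms in \<open>auto simp: in_keys_iff\<close>)

lemma poly_eval_zero [simp]: "poly_eval x 0 = 0"
  by (simp add: poly_eval_def)

lemma poly_eval_single: "poly_eval x (Poly_Mapping.single m c) = of_rat c * monom_eval x m"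
  by (simp add: poly_eval_superset[of "{m}"])

lemma poly_eval_add: "poly_eval x (P + Q) = poly_eval x P + poly_eval x Q"
proof -
  let ?A = "Poly_Mapping.keys P \<union> Poly_Mapping.keys Q"
  have "Poly_Mapping.keys (P + Q) \<subseteq> ?A" by (rule Poly_Mapping.keys_add)
  then show ?thesis
    by (simp add: poly_eval_superset[of ?A] lookup_add of_rat_add distrib_right sum.distrib)
qed

lemma poly_eval_sum: "poly_eval x (\<Sum>a\<in>A. P a) = (\<Sum>a\<in>A. poly_eval x (P a))"
  by (induction A rule: infinite_finite_induct) (auto simp: poly_eval_add)

lemma poly_mapping_sum_single:
  "P = (\<Sum>m\<in>Poly_Mapping.keys P. Poly_Mapping.single m (Poly_Mapping.lookup P m))"
  by (rule poly_mapping_eqI) (auto simp: lookup_sum lookup_single when_def in_keys_iff)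

lemma poly_eval_mult: "poly_eval x (P * Q) = poly_eval x P * poly_eval x Q"
proof -
  have "P * Q = (\<Sum>m\<in>Poly_Mapping.keys P. \<Sum>n\<in>Poly_Mapping.keys Q.
      Poly_Mapping.single (m + n) (Poly_Mapping.lookup P m * Poly_Mapping.lookup Q n))"
    by (subst (1) poly_mapping_sum_single[of P], subst (1) poly_mapping_sum_single[of Q])
      (simp add: sum_product mult_single)
  then have "poly_eval x (P * Q) = (\<Sum>m\<in>Poly_Mapping.keys P. \<Sum>n\<in>Poly_Mapping.keys Q.
      (of_rat (Poly_Mapping.lookup P m) * monom_eval x m) *
      (of_rat (Poly_Mapping.lookup Q n) * monom_eval x n))"
    by (simp add: poly_eval_sum poly_eval_single monom_eval_add of_rat_mult mult_ac)
  then show ?thesis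
    by (simp add: poly_eval_superset[of "Poly_Mapping.keys P" P]
        poly_eval_superset[of "Poly_Mapping.keys Q" Q] sum_product)
qed

section \<open>Countability of rational polynomials and existence of generic realizations\<close>

lemma countable_poly_mappings:
  assumes "finite I"
  shows "countable {P :: ('i \<Rightarrow>\<^sub>0 nat) \<Rightarrow>\<^sub>0 rat. \<forall>m\<in>Poly_Mapping.keys P. Poly_Mapping.keys m \<subseteq> I}"
    (is "countable ?S")
proof -
  let ?M = "{m :: 'i \<Rightarrow>\<^sub>0 nat. Poly_Mapping.keys m \<subseteq> I}"
  have "inj_on (\<lambda>m. restrict (Poly_Mapping.lookup m) I) ?M"
  proof (rule inj_onI)
    fix m n :: "'i \<Rightarrow>\<^sub>0 nat"
    assume mn: "m \<in> ?M" "n \<in> ?M" and eq: "restrict (Poly_Mapping.lookup m) I = restrict (Poly_Mapping.lookup n) I"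
    show "m = n"
    proof (rule poly_mapping_eqI)
      fix i
      show "Poly_Mapping.lookup m i = Poly_Mapping.lookup n i"
      proof (cases "i \<in> I")
        case True
        then show ?thesis using fun_cong[OF eq, of i] by simp
      next
        case False
        then have "i \<notin> Poly_Mapping.keys m" "i \<notin> Poly_Mapping.keys n" using mn by auto
        then show ?thesis by (simp add: in_keys_iff)
      qed
    qed
  qed
  moreover have "(\<lambda>m. restrict (Poly_Mapping.lookup m) I) ` ?M \<subseteq> (I \<rightarrow>\<^sub>E UNIV)"
    by auto
  moreover have "countable (I \<rightarrow>\<^sub>E (UNIV :: nat set))"
    using assms by (intro countable_PiE) auto
  ultimately have M: "countable ?M"
    by (meson countable_image_inj_on countable_subset)
  let ?F = "\<lambda>A. (\<lambda>f. \<Sum>m\<in>A. Poly_Mapping.single m (f m)) ` (A \<rightarrow>\<^sub>E (UNIV :: rat set))"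
  have "?S \<subseteq> (\<Union>A\<in>{A. finite A \<and> A \<subseteq> ?M}. ?F A)"
  proof
    fix P assume P: "P \<in> ?S"
    have "P \<in> ?F (Poly_Mapping.keys P)"
    proof (rule image_eqI)
      show "P = (\<Sum>m\<in>Poly_Mapping.keys P. Poly_Mapping.single m
          (restrict (Poly_Mapping.lookup P) (Poly_Mapping.keys P) m))"
        using poly_mapping_sum_single[of P] by simp
    qed auto
    moreover have "Poly_Mapping.keys P \<in> {A. finite A \<and> A \<subseteq> ?M}" using P by auto
    ultimately show "P \<in> (\<Union>A\<in>{A. finite A \<and> A \<subseteq> ?M}. ?F A)" by blast
  qed
  moreover have "countable (\<Union>A\<in>{A. finite A \<and> A \<subseteq> ?M}. ?F A)"
    using M by (intro countable_UN countable_Collect_finite_subset countable_image countable_PiE) auto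
  ultimately show ?thesis by (rule countable_subset)
qed

text \<open>Cardinality: the values at \<open>x\<close> of rational polynomials over
  \<open>I\<close> form a countable set, so only countably many reals are roots of nonzero
  polynomials with such coefficients. Any other real serves as \<open>y\<close>.\<close>

lemma alg_independent_rat_extend:
  assumes "finite I" "i \<notin> I" "alg_independent_rat I x"
  shows "\<exists>y. alg_independent_rat (insert i I) (x(i := y))"
proof -
  let ?R = "poly_eval x ` {P. \<forall>m\<in>Poly_Mapping.keys P. Poly_Mapping.keys m \<subseteq> I}"
  let ?C = "{Q :: real poly. \<forall>k. coeff Q k \<in> ?R}"
  have R: "countable ?R" using assms(1) by (intro countable_image countable_poly_mappings)
  have "countable (Poly ` lists ?R)"
    using R by (intro countable_image) (simp add: countable_lists)
  moreover have "?C \<subseteq> Poly ` lists ?R"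
  proof
    fix Q assume "Q \<in> ?C"
    then show "Q \<in> Poly ` lists ?R"
      by (intro image_eqI[of _ _ "coeffs Q"]) (simp, auto simp: in_lists_conv_set coeffs_def)
  qed
  ultimately have "countable ?C" by (rule countable_subset[rotated])
  then have "countable (\<Union>Q\<in>?C - {0}. {y. poly Q y = 0})"
    by (intro countable_UN) (auto intro: countable_finite poly_roots_finite)
  then have "(\<Union>Q\<in>?C - {0}. {y. poly Q y = 0}) \<noteq> UNIV"
    using uncountable_UNIV_real by metis
  then obtain y where y: "\<And>Q. Q \<in> ?C \<Longrightarrow> poly Q y = 0 \<Longrightarrow> Q = 0" by blast
  have "alg_independent_rat (insert i I) (x(i := y))"
    unfolding alg_independent_rat_def
  proof (intro allI impI)
    fix P :: "('a \<Rightarrow>\<^sub>0 nat) \<Rightarrow>\<^sub>0 rat"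
    assume keysP: "\<forall>m\<in>Poly_Mapping.keys P. Poly_Mapping.keys m \<subseteq> insert i I"
      and P0: "poly_eval (x(i := y)) P = 0"
    define c where "c m = Poly_Mapping.lookup P m" for m
    \<comment> \<open>View \<open>P\<close> as a polynomial in the indeterminate \<open>i\<close>:
      \<open>e m\<close> is the degree of \<open>m\<close> in \<open>i\<close>, \<open>r m\<close>
      is \<open>m\<close> stripped of \<open>i\<close>, and \<open>Pk k\<close> is the coefficient
      of the power \<open>k\<close>.\<close>
    define e where "e m = Poly_Mapping.lookup m i" for m :: "'a \<Rightarrow>\<^sub>0 nat"
    define r where "r m = m - Poly_Mapping.single i (e m)" for m
    have lr: "Poly_Mapping.lookup (r m) j = (if j = i then 0 else Poly_Mapping.lookup m j)" for m j
      by (simp add: r_def e_def lookup_minus lookup_single when_def)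
    have kr: "Poly_Mapping.keys (r m) \<subseteq> I" if "m \<in> Poly_Mapping.keys P" for m
    proof
      fix j assume "j \<in> Poly_Mapping.keys (r m)"
      then have "j \<noteq> i" "j \<in> Poly_Mapping.keys m" by (auto simp: in_keys_iff lr split: if_splits)
      then show "j \<in> I" using that keysP by auto
    qed
    have rm: "m = r m + Poly_Mapping.single i (e m)" for m
      by (rule poly_mapping_eqI) (simp add: lookup_add lr lookup_single when_def e_def)
    define K where "K k = {m \<in> Poly_Mapping.keys P. e m = k}" for k
    define Pk where "Pk k = (\<Sum>m\<in>K k. Poly_Mapping.single (r m) (c m))" for k
    have finK: "finite (K k)" for k by (simp add: K_def)
    have keysPk: "\<forall>m\<in>Poly_Mapping.keys (Pk k). Poly_Mapping.keys m \<subseteq> I" for k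
    proof
      fix m assume "m \<in> Poly_Mapping.keys (Pk k)"
      then have "(\<Sum>n\<in>K k. Poly_Mapping.lookup (Poly_Mapping.single (r n) (c n)) m) \<noteq> 0"
        by (simp add: Pk_def in_keys_iff lookup_sum)
      then obtain n where "n \<in> K k" "Poly_Mapping.lookup (Poly_Mapping.single (r n) (c n)) m \<noteq> 0"
        by (rule sum.not_neutral_contains_not_neutral)
      then have "n \<in> K k" "m = r n" by (auto simp: lookup_single when_def split: if_splits)
      then show "Poly_Mapping.keys m \<subseteq> I" using kr by (simp add: K_def)
    qed
    have mx: "monom_eval (x(i := y)) m = monom_eval x (r m) * y ^ e m" if "m \<in> Poly_Mapping.keys P" for m
    proof -
      have "monom_eval (x(i := y)) (r m) = monom_eval x (r m)"
        unfolding monom_eval_def using kr[OF that] assms(2) by (intro prod.cong) auto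
      moreover have "monom_eval (x(i := y)) (Poly_Mapping.single i (e m)) = y ^ e m"
        by (simp add: monom_eval_superset[of "{i}"])
      ultimately show ?thesis by (subst rm) (simp only: monom_eval_add)
    qed
    define Q where "Q = (\<Sum>m\<in>Poly_Mapping.keys P. monom (of_rat (c m) * monom_eval x (r m)) (e m))"
    have cQ: "coeff Q k = poly_eval x (Pk k)" for k
    proof -
      have "coeff Q k = (\<Sum>m\<in>Poly_Mapping.keys P. if e m = k then of_rat (c m) * monom_eval x (r m) else 0)"
        unfolding Q_def by (simp add: coeff_sum)
      also have "\<dots> = (\<Sum>m\<in>K k. of_rat (c m) * monom_eval x (r m))"
        unfolding K_def by (simp add: sum.If_cases Int_def conj_commute)
      finally show ?thesis by (simp add: Pk_def poly_eval_sum poly_eval_single)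
    qed
    have "poly Q y = 0"
      using P0 mx by (simp add: Q_def poly_sum poly_monom poly_eval_superset[of "Poly_Mapping.keys P" P]
          c_def mult.assoc)
    moreover have "Q \<in> ?C"
      using keysPk cQ by auto
    ultimately have "Q = 0" using y by blast
    then have Pk0: "Pk k = 0" for k
      using cQ[of k] assms(3) keysPk[of k] unfolding alg_independent_rat_def by auto
    show "P = 0"
    proof (rule ccontr)
      assume "P \<noteq> 0"
      then obtain m where m: "m \<in> Poly_Mapping.keys P" by (metis keys_eq_empty equals0I)
      \<comment> \<open>Monomials of equal degree in \<open>i\<close> are told apart by
        \<open>r\<close>, so nothing cancels in \<open>Pk (e m)\<close>.\<close>
      have inj: "n = m" if "n \<in> K (e m)" "r n = r m" for n
        using that rm[of n] rm[of m] by (simp add: K_def)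
      have "Poly_Mapping.lookup (Pk (e m)) (r m) = (\<Sum>n\<in>K (e m). if n = m then c m else 0)"
        unfolding Pk_def using inj
        by (auto simp: lookup_sum lookup_single when_def intro!: sum.cong)
      also have "\<dots> = c m" using m finK by (simp add: K_def)
      finally show False using Pk0 m by (simp add: c_def in_keys_iff)
    qed
  qed
  then show ?thesis ..
qed

lemma poly_eval_cong:
  assumes "\<And>m i. m \<in> Poly_Mapping.keys P \<Longrightarrow> i \<in> Poly_Mapping.keys m \<Longrightarrow> x i = y i"
  shows "poly_eval x P = poly_eval y P"
proof -
  have "(\<Prod>i\<in>Poly_Mapping.keys m. x i ^ Poly_Mapping.lookup m i) =
      (\<Prod>i\<in>Poly_Mapping.keys m. y i ^ Poly_Mapping.lookup m i)" if "m \<in> Poly_Mapping.keys P" for m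
    using assms[OF that] by simp
  then show ?thesis unfolding poly_eval_def by simp
qed

lemma alg_independent_rat_exists:
  assumes "finite I"
  shows "\<exists>x. alg_independent_rat I x"
  using assms
proof (induction I rule: finite_induct)
  case empty
  have "alg_independent_rat {} (\<lambda>_ :: 'a. 0)"
    unfolding alg_independent_rat_def
  proof (intro allI impI)
    fix P :: "('a \<Rightarrow>\<^sub>0 nat) \<Rightarrow>\<^sub>0 rat"
    assume *: "\<forall>m\<in>Poly_Mapping.keys P. Poly_Mapping.keys m \<subseteq> {}" "poly_eval (\<lambda>_ :: 'a. 0) P = 0"
    then have sub: "Poly_Mapping.keys P \<subseteq> {0}" by auto
    have "poly_eval (\<lambda>_. 0) P = of_rat (Poly_Mapping.lookup P 0)"
      by (subst poly_eval_superset[OF _ sub]) (simp_all add: monom_eval_def)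
    then have "0 \<notin> Poly_Mapping.keys P" using *(2) by (simp add: in_keys_iff)
    then show "P = 0" using sub by (metis keys_eq_empty subset_singletonD insertI1)
  qed
  then show ?case by blast
next
  case (insert i I)
  then obtain x where "alg_independent_rat I x" by blast
  from alg_independent_rat_extend[OF insert.hyps this] show ?case by blast
qed

lemma generic_exists:
  assumes "finite V"
  shows "\<exists>p :: 'a \<Rightarrow> real ^ 'd::finite. p \<in> realizations V \<and> generic V p"
proof -
  obtain x :: "'a \<times> 'd \<Rightarrow> real" where x: "alg_independent_rat (V \<times> UNIV) x"
    using alg_independent_rat_exists[of "V \<times> (UNIV :: 'd set)"] assms by auto
  define p :: "'a \<Rightarrow> real ^ 'd" where "p = restrict (\<lambda>v. \<chi> i. x (v, i)) V"
  have "poly_eval (\<lambda>(v, i). p v $ i) P = poly_eval x P"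
    if "\<forall>m\<in>Poly_Mapping.keys P. Poly_Mapping.keys m \<subseteq> V \<times> UNIV" for P
  proof (rule poly_eval_cong, clarify)
    fix m v i assume "m \<in> Poly_Mapping.keys P" "(v, i) \<in> Poly_Mapping.keys m"
    with that have "v \<in> V" by blast
    then show "p v $ i = x (v, i)" by (simp add: p_def)
  qed
  then have "generic V p" using x unfolding generic_def alg_independent_rat_def by simp
  then show ?thesis by (intro exI[of _ p]) (simp add: p_def)
qed

lemma generic_subset: "generic V p \<Longrightarrow> W \<subseteq> V \<Longrightarrow> generic W p"
  unfolding generic_def alg_independent_rat_def
proof (intro allI impI)
  fix P :: "('a \<times> 'b \<Rightarrow>\<^sub>0 nat) \<Rightarrow>\<^sub>0 rat"
  assume gen: "\<forall>P. (\<forall>m\<in>Poly_Mapping.keys P. Poly_Mapping.keys m \<subseteq> V \<times> UNIV) \<longrightarrow>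
      poly_eval (\<lambda>(v, i). p v $ i) P = 0 \<longrightarrow> P = 0" and "W \<subseteq> V"
    and P: "\<forall>m\<in>Poly_Mapping.keys P. Poly_Mapping.keys m \<subseteq> W \<times> UNIV"
      "poly_eval (\<lambda>(v, i). p v $ i) P = 0"
  have "\<forall>m\<in>Poly_Mapping.keys P. Poly_Mapping.keys m \<subseteq> V \<times> UNIV"
    using P(1) \<open>W \<subseteq> V\<close> by (meson Sigma_mono order_refl order_trans)
  with gen P(2) show "P = 0" by blast
qed

section \<open>Polynomial functions on realizations and ranks at generic points\<close>

text \<open>Functions rather than formal polynomials, so that vanishing everywhere and derivatives
  along a line can be stated directly. Constants are rational because genericity speaks of rational
  polynomials.\<close>

inductive poly_fun :: "'a set \<Rightarrow> (('a \<Rightarrow> real ^ 'd) \<Rightarrow> real) \<Rightarrow> bool" for V where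
  const: "poly_fun V (\<lambda>_. of_rat c)"
| coord: "v \<in> V \<Longrightarrow> poly_fun V (\<lambda>p. p v $ i)"
| add: "poly_fun V f \<Longrightarrow> poly_fun V g \<Longrightarrow> poly_fun V (\<lambda>p. f p + g p)"
| mult: "poly_fun V f \<Longrightarrow> poly_fun V g \<Longrightarrow> poly_fun V (\<lambda>p. f p * g p)"

lemma poly_fun_0 [intro]: "poly_fun V (\<lambda>_. 0)"
  using poly_fun.const[of V 0] by simp

lemma poly_fun_1 [intro]: "poly_fun V (\<lambda>_. 1)"
  using poly_fun.const[of V 1] by simp

lemma poly_fun_diff [intro]:
  assumes "poly_fun V f" "poly_fun V g"
  shows "poly_fun V (\<lambda>p. f p - g p)"
  using poly_fun.add[OF assms(1) poly_fun.mult[OF poly_fun.const[of V "-1"] assms(2)]] by simp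

lemma poly_fun_sum [intro]:
  assumes "\<And>a. a \<in> A \<Longrightarrow> poly_fun V (f a)"
  shows "poly_fun V (\<lambda>p. \<Sum>a\<in>A. f a p)"
  using assms by (induction A rule: infinite_finite_induct) (auto intro: poly_fun.add)

lemma poly_fun_power [intro]: "poly_fun V f \<Longrightarrow> poly_fun V (\<lambda>p. f p ^ n)"
  by (induction n) (auto intro: poly_fun.mult)

lemma poly_fun_poly_eval:
  fixes f :: "('a \<Rightarrow> real ^ 'd::finite) \<Rightarrow> real"
  assumes "poly_fun V f"
  shows "\<exists>P. (\<forall>m\<in>Poly_Mapping.keys P. Poly_Mapping.keys m \<subseteq> V \<times> UNIV) \<and>
    (\<forall>p. f p = poly_eval (\<lambda>(v, i). p v $ i) P)"
  using assms
proof induction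
  case (const c)
  show ?case
    by (intro exI[of _ "Poly_Mapping.single 0 c"]) (auto simp: poly_eval_single monom_eval_def)
next
  case (coord v i)
  have "monom_eval x (Poly_Mapping.single (v, i) (1::nat)) = x (v, i)" for x
    by (simp add: monom_eval_superset[of "{(v, i)}"])
  then show ?case using coord
    by (intro exI[of _ "Poly_Mapping.single (Poly_Mapping.single (v, i) 1) 1"])
      (auto simp: poly_eval_single)
next
  case (add f g)
  then obtain P Q where PQ: "\<forall>m\<in>Poly_Mapping.keys P. Poly_Mapping.keys m \<subseteq> V \<times> UNIV"
    "\<forall>m\<in>Poly_Mapping.keys Q. Poly_Mapping.keys m \<subseteq> V \<times> UNIV"
    "\<And>p. f p = poly_eval (\<lambda>(v, i). p v $ i) P" "\<And>p. g p = poly_eval (\<lambda>(v, i). p v $ i) Q"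
    by metis
  show ?case
  proof (intro exI[of _ "P + Q"] conjI ballI)
    fix m assume "m \<in> Poly_Mapping.keys (P + Q)"
    then have "m \<in> Poly_Mapping.keys P \<union> Poly_Mapping.keys Q"
      using Poly_Mapping.keys_add[of P Q] by (rule subsetD[rotated])
    then show "Poly_Mapping.keys m \<subseteq> V \<times> UNIV" using PQ by auto
  qed (simp add: PQ poly_eval_add)
next
  case (mult f g)
  then obtain P Q where PQ: "\<forall>m\<in>Poly_Mapping.keys P. Poly_Mapping.keys m \<subseteq> V \<times> UNIV"
    "\<forall>m\<in>Poly_Mapping.keys Q. Poly_Mapping.keys m \<subseteq> V \<times> UNIV"
    "\<And>p. f p = poly_eval (\<lambda>(v, i). p v $ i) P" "\<And>p. g p = poly_eval (\<lambda>(v, i). p v $ i) Q"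
    by metis
  show ?case
  proof (intro exI[of _ "P * Q"] conjI ballI)
    fix m assume "m \<in> Poly_Mapping.keys (P * Q)"
    then obtain a b where "m = a + b" "a \<in> Poly_Mapping.keys P" "b \<in> Poly_Mapping.keys Q"
      using subsetD[OF Poly_Mapping.keys_mult[of P Q]] by blast
    moreover have "Poly_Mapping.keys (a + b) \<subseteq> Poly_Mapping.keys a \<union> Poly_Mapping.keys b"
      by (rule Poly_Mapping.keys_add)
    ultimately show "Poly_Mapping.keys m \<subseteq> V \<times> UNIV" using PQ(1,2) by blast
  qed (simp add: PQ poly_eval_mult)
qed

text \<open>The representing polynomial is 0. Used mostly in the contrapositive: a polynomial
  function that is nonzero at one realization is nonzero at every generic one.\<close>

lemma generic_poly_fun_zero:
  assumes "generic V p" "poly_fun V f" "f p = 0"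
  shows "f q = 0"
proof -
  obtain P where P: "\<forall>m\<in>Poly_Mapping.keys P. Poly_Mapping.keys m \<subseteq> V \<times> UNIV"
    "\<And>p. f p = poly_eval (\<lambda>(v, i). p v $ i) P" using poly_fun_poly_eval[OF assms(2)] by blast
  with assms have "P = 0" unfolding generic_def alg_independent_rat_def by metis
  then show ?thesis using P by simp
qed

text \<open>Fraction-free Gaussian elimination, with the pivots chosen to be nonzero at \<open>q0\<close>.\<close>

lemma rows_independent_poly_fun:
  fixes r :: "'k \<Rightarrow> 'j \<Rightarrow> ('a \<Rightarrow> real ^ 'd::finite) \<Rightarrow> real"
  assumes "finite F" "\<And>k j. k \<in> F \<Longrightarrow> j \<in> J \<Longrightarrow> poly_fun V (r k j)"
    and "\<And>c k. \<forall>j\<in>J. (\<Sum>k\<in>F. c k * r k j q0) = 0 \<Longrightarrow> k \<in> F \<Longrightarrow> c k = 0"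
  shows "\<exists>g. poly_fun V g \<and> g q0 \<noteq> 0 \<and>
    (\<forall>q. g q \<noteq> 0 \<longrightarrow> (\<forall>c. (\<forall>j\<in>J. (\<Sum>k\<in>F. c k * r k j q) = 0) \<longrightarrow> (\<forall>k\<in>F. c k = 0)))"
  using assms
proof (induction F arbitrary: r rule: finite_induct)
  case empty
  show ?case by (intro exI[of _ "\<lambda>_. 1"]) auto
next
  case (insert l F)
  have "\<exists>j\<in>J. r l j q0 \<noteq> 0"
  proof (rule ccontr)
    assume "\<not> (\<exists>j\<in>J. r l j q0 \<noteq> 0)"
    then have "\<forall>j\<in>J. (\<Sum>k\<in>insert l F. (if k = l then 1 else 0) * r k j q0) = 0"
      by (simp add: insert.hyps if_distrib[of "\<lambda>u. u * _"] cong: if_cong)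
    from insert.prems(2)[OF this, of l] show False by simp
  qed
  then obtain j0 where j0: "j0 \<in> J" "r l j0 q0 \<noteq> 0" by blast
  \<comment> \<open>Row \<open>k\<close> with its entry in the pivot column \<open>j0\<close>
    cleared by cross-multiplication, which keeps the entries polynomial.\<close>
  define s where "s k j q = r l j0 q * r k j q - r k j0 q * r l j q" for k j q
  have comb: "(\<Sum>k\<in>F. c k * s k j q) =
      r l j0 q * (\<Sum>k\<in>F. c k * r k j q) - r l j q * (\<Sum>k\<in>F. c k * r k j0 q)" for c j q
    by (simp add: s_def algebra_simps sum_subtractf sum_distrib_left)
  have "\<exists>g. poly_fun V g \<and> g q0 \<noteq> 0 \<and>
    (\<forall>q. g q \<noteq> 0 \<longrightarrow> (\<forall>c. (\<forall>j\<in>J. (\<Sum>k\<in>F. c k * s k j q) = 0) \<longrightarrow> (\<forall>k\<in>F. c k = 0)))"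
  proof (rule insert.IH)
    show "poly_fun V (s k j)" if "k \<in> F" "j \<in> J" for k j
      unfolding s_def using that insert.prems(1) j0
      by (intro poly_fun_diff poly_fun.mult) auto
  next
    fix c k
    assume c: "\<forall>j\<in>J. (\<Sum>k\<in>F. c k * s k j q0) = 0" and k: "k \<in> F"
    \<comment> \<open>Lifts a relation of the reduced rows \<open>s\<close> to a relation of the
      rows \<open>r\<close> by solving for the coefficient of the pivot row.\<close>
    define c' where "c' k = (if k = l then - (\<Sum>k\<in>F. c k * r k j0 q0) else r l j0 q0 * c k)" for k
    have "\<forall>j\<in>J. (\<Sum>k\<in>insert l F. c' k * r k j q0) = 0"
    proof
      fix j assume "j \<in> J"
      have "(\<Sum>k\<in>F. c' k * r k j q0) = (\<Sum>k\<in>F. r l j0 q0 * (c k * r k j q0))"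
        using insert.hyps by (intro sum.cong) (auto simp: c'_def)
      then have "(\<Sum>k\<in>insert l F. c' k * r k j q0) = (\<Sum>k\<in>F. c k * s k j q0)"
        using insert.hyps unfolding comb by (simp add: c'_def[of l] sum_distrib_left[symmetric])
      then show "(\<Sum>k\<in>insert l F. c' k * r k j q0) = 0" using c \<open>j \<in> J\<close> by simp
    qed
    from insert.prems(2)[OF this, of k] k have "c' k = 0" by simp
    moreover have "k \<noteq> l" using k insert.hyps by blast
    ultimately show "c k = 0" using j0 by (simp add: c'_def)
  qed
  then obtain g where g: "poly_fun V g" "g q0 \<noteq> 0"
    "\<And>q c k. g q \<noteq> 0 \<Longrightarrow> \<forall>j\<in>J. (\<Sum>k\<in>F. c k * s k j q) = 0 \<Longrightarrow> k \<in> F \<Longrightarrow> c k = 0" by blast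
  show ?case
  proof (intro exI[of _ "\<lambda>q. g q * r l j0 q"] conjI allI impI)
    show "poly_fun V (\<lambda>q. g q * r l j0 q)" using g insert.prems(1) j0 by (intro poly_fun.mult) auto
    show "g q0 * r l j0 q0 \<noteq> 0" using g j0 by simp
    fix q c
    assume q: "g q * r l j0 q \<noteq> 0" and c: "\<forall>j\<in>J. (\<Sum>k\<in>insert l F. c k * r k j q) = 0"
    have F: "(\<Sum>k\<in>F. c k * r k j q) = - c l * r l j q" if "j \<in> J" for j
      using c that insert.hyps by (simp add: eq_neg_iff_add_eq_0 add.commute)
    have "\<forall>j\<in>J. (\<Sum>k\<in>F. c k * s k j q) = 0"
      unfolding comb using F j0 by simp
    then have cF: "\<forall>k\<in>F. c k = 0" using g(3) q by auto
    then have "c l * r l j0 q = 0" using F[OF j0(1)] by simp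
    then show "\<forall>k\<in>insert l F. c k = 0" using cF q by auto
  qed
qed

text \<open>Independence at a single, possibly very special, \<open>q0\<close> is witnessed by a
  polynomial \<open>g\<close> that is nonzero there, hence nonzero at the generic
  \<open>p\<close>.\<close>

lemma rows_independent_generic:
  fixes r :: "'k \<Rightarrow> 'j \<Rightarrow> ('a \<Rightarrow> real ^ 'd::finite) \<Rightarrow> real"
  assumes "finite F" "\<And>k j. k \<in> F \<Longrightarrow> j \<in> J \<Longrightarrow> poly_fun V (r k j)"
    and "\<And>c k. \<forall>j\<in>J. (\<Sum>k\<in>F. c k * r k j q0) = 0 \<Longrightarrow> k \<in> F \<Longrightarrow> c k = 0"
    and "generic V p" "\<forall>j\<in>J. (\<Sum>k\<in>F. c k * r k j p) = 0" "k \<in> F"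
  shows "c k = 0"
proof -
  have "\<exists>g. poly_fun V g \<and> g q0 \<noteq> 0 \<and>
    (\<forall>q. g q \<noteq> 0 \<longrightarrow> (\<forall>c. (\<forall>j\<in>J. (\<Sum>k\<in>F. c k * r k j q) = 0) \<longrightarrow> (\<forall>k\<in>F. c k = 0)))"
    using assms(1-3) by (rule rows_independent_poly_fun)
  then obtain g where g: "poly_fun V g" "g q0 \<noteq> 0"
    and ind: "\<forall>q. g q \<noteq> 0 \<longrightarrow>
      (\<forall>c. (\<forall>j\<in>J. (\<Sum>k\<in>F. c k * r k j q) = 0) \<longrightarrow> (\<forall>k\<in>F. c k = 0))"
    by (elim exE conjE)
  have "g p \<noteq> 0" using generic_poly_fun_zero[OF assms(4) g(1)] g(2) by auto
  then show ?thesis using ind assms(5,6) by blast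
qed

section \<open>Derivations of the real numbers\<close>

definition derivation :: "(real \<Rightarrow> real) \<Rightarrow> bool" where
  "derivation D \<longleftrightarrow> (\<forall>x y. D (x + y) = D x + D y) \<and> (\<forall>x y. D (x * y) = x * D y + D x * y)"

text \<open>The graph of a derivation on a subring of the reals, as a subring of the dual numbers.\<close>

definition derivation_graph :: "(real \<times> real) set \<Rightarrow> bool" where
  "derivation_graph G \<longleftrightarrow> (1, 0) \<in> G \<and>
     (\<forall>x a y b. (x, a) \<in> G \<longrightarrow> (y, b) \<in> G \<longrightarrow> (x - y, a - b) \<in> G \<and> (x * y, x * b + a * y) \<in> G) \<and>
     (\<forall>a. (0, a) \<in> G \<longrightarrow> a = 0)"

lemma derivation_graphD:
  assumes "derivation_graph G"
  shows derivation_graph_1: "(1, 0) \<in> G"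
    and derivation_graph_diff: "(x, a) \<in> G \<Longrightarrow> (y, b) \<in> G \<Longrightarrow> (x - y, a - b) \<in> G"
    and derivation_graph_mult: "(x, a) \<in> G \<Longrightarrow> (y, b) \<in> G \<Longrightarrow> (x * y, x * b + a * y) \<in> G"
    and derivation_graph_0D: "(0, a) \<in> G \<Longrightarrow> a = 0"
  using assms unfolding derivation_graph_def by blast+

lemma derivation_graph_0: "derivation_graph G \<Longrightarrow> (0, 0) \<in> G"
  using derivation_graph_diff[OF _ derivation_graph_1 derivation_graph_1, of G] by simp

lemma derivation_graph_add:
  assumes "derivation_graph G" "(x, a) \<in> G" "(y, b) \<in> G"
  shows "(x + y, a + b) \<in> G"
  using derivation_graph_diff[OF assms(1,2) derivation_graph_diff[OF assms(1) derivation_graph_0[OF assms(1)] assms(3)]]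
  by simp

lemma derivation_graph_sum:
  assumes "derivation_graph G" "\<And>i. i \<in> A \<Longrightarrow> (f i, g i) \<in> G"
  shows "(sum f A, sum g A) \<in> G"
  using assms(2)
  by (induction A rule: infinite_finite_induct)
    (auto intro: derivation_graph_0 derivation_graph_add assms(1))

lemma derivation_graph_unique:
  assumes "derivation_graph G" "(x, a) \<in> G" "(x, b) \<in> G"
  shows "a = b"
  using derivation_graph_0D[OF assms(1), of "a - b"] derivation_graph_diff[OF assms] by simp

text \<open>Polynomials over the dual numbers with coefficients in \<open>G\<close> are encoded as pairs of real
  polynomials; their values at the dual number \<open>(y, b)\<close> form the subring generated by \<open>G\<close> and
  \<open>(y, b)\<close>.\<close>

definition graph_polys :: "(real \<times> real) set \<Rightarrow> (real poly \<times> real poly) set" where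
  "graph_polys G = {(P, Q). \<forall>i. (coeff P i, coeff Q i) \<in> G}"

text \<open>The coefficient of \<epsilon> in (P + \<epsilon> Q)(y + \<epsilon> b), where \<epsilon>
  squares to 0.\<close>

definition dual_value :: "real \<Rightarrow> real \<Rightarrow> real poly \<Rightarrow> real poly \<Rightarrow> real" where
  "dual_value y b P Q = poly Q y + poly (pderiv P) y * b"

definition adjoin :: "(real \<times> real) set \<Rightarrow> real \<Rightarrow> real \<Rightarrow> (real \<times> real) set" where
  "adjoin G y b = {(poly P y, dual_value y b P Q) |P Q. (P, Q) \<in> graph_polys G}"

lemma graph_polys_diff:
  assumes "derivation_graph G" "(P, Q) \<in> graph_polys G" "(P', Q') \<in> graph_polys G"
  shows "(P - P', Q - Q') \<in> graph_polys G"
  using assms(2,3) by (auto simp: graph_polys_def intro: derivation_graph_diff[OF assms(1)])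

lemma graph_polys_mult:
  assumes "derivation_graph G" "(P, Q) \<in> graph_polys G" "(P', Q') \<in> graph_polys G"
  shows "(P * P', P * Q' + Q * P') \<in> graph_polys G"
  using assms(2,3)
  by (auto simp: graph_polys_def coeff_mult simp flip: sum.distrib
      intro!: derivation_graph_sum[OF assms(1)] derivation_graph_mult[OF assms(1)])

lemma graph_polys_monom:
  assumes "derivation_graph G" "(x, a) \<in> G"
  shows "(monom x n, monom a n) \<in> graph_polys G"
  using assms by (auto simp: graph_polys_def derivation_graph_0)

lemma graph_polys_0D:
  assumes "derivation_graph G" "(0, Q) \<in> graph_polys G"
  shows "Q = 0"
  using assms(2) derivation_graph_0D[OF assms(1)] by (auto simp: graph_polys_def poly_eq_iff)

lemma dual_value_diff: "dual_value y b (P - P') (Q - Q') = dual_value y b P Q - dual_value y b P' Q'"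
  by (simp add: dual_value_def pderiv_diff algebra_simps)

lemma dual_value_mult:
  "dual_value y b (P * P') (P * Q' + Q * P') =
     poly P y * dual_value y b P' Q' + dual_value y b P Q * poly P' y"
  by (simp add: dual_value_def pderiv_mult algebra_simps)

lemma adjoin_contains:
  assumes "derivation_graph G"
  shows "G \<subseteq> adjoin G y b" "(y, b) \<in> adjoin G y b"
proof -
  have "(x, a) \<in> adjoin G y b" if "(x, a) \<in> G" for x a
    unfolding adjoin_def using graph_polys_monom[OF assms that, of 0]
    by (intro CollectI exI[of _ "monom x 0"] exI[of _ "monom a 0"])
      (simp add: dual_value_def poly_monom pderiv_monom)
  then show "G \<subseteq> adjoin G y b" by auto
  show "(y, b) \<in> adjoin G y b"
    unfolding adjoin_def using graph_polys_monom[OF assms derivation_graph_1[OF assms], of 1]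
    by (intro CollectI exI[of _ "monom 1 1"] exI[of _ "monom 0 1"])
      (simp add: dual_value_def poly_monom pderiv_monom)
qed

text \<open>The ring axioms hold for every \<open>b\<close>; the assumption \<open>wd\<close> is
  what keeps the new graph single-valued.\<close>

lemma derivation_graph_adjoin:
  assumes G: "derivation_graph G"
    and wd: "\<And>P Q. (P, Q) \<in> graph_polys G \<Longrightarrow> poly P y = 0 \<Longrightarrow> dual_value y b P Q = 0"
  shows "derivation_graph (adjoin G y b)"
  unfolding derivation_graph_def
proof (intro conjI allI impI)
  show "(1, 0) \<in> adjoin G y b" using adjoin_contains(1)[OF G] derivation_graph_1[OF G] by blast
  show "a = 0" if "(0, a) \<in> adjoin G y b" for a
    using that wd by (auto simp: adjoin_def)
  fix x a x' a'
  assume "(x, a) \<in> adjoin G y b" "(x', a') \<in> adjoin G y b"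
  then obtain P Q P' Q' where PQ: "(P, Q) \<in> graph_polys G" "(P', Q') \<in> graph_polys G"
    "x = poly P y" "a = dual_value y b P Q" "x' = poly P' y" "a' = dual_value y b P' Q'"
    by (auto simp: adjoin_def)
  show "(x - x', a - a') \<in> adjoin G y b"
    unfolding adjoin_def using graph_polys_diff[OF G PQ(1,2)]
    by (intro CollectI exI[of _ "P - P'"] exI[of _ "Q - Q'"]) (simp add: PQ dual_value_diff)
  show "(x * x', x * a' + a * x') \<in> adjoin G y b"
    unfolding adjoin_def using graph_polys_mult[OF G PQ(1,2)]
    by (intro CollectI exI[of _ "P * P'"] exI[of _ "P * Q' + Q * P'"]) (simp add: PQ dual_value_mult)
qed

lemma derivation_graph_adjoin_transcendental:
  assumes G: "derivation_graph G"
    and tr: "\<And>P. \<forall>i. coeff P i \<in> fst ` G \<Longrightarrow> poly P y = 0 \<Longrightarrow> P = 0"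
  shows "derivation_graph (adjoin G y b)"
proof (rule derivation_graph_adjoin[OF G])
  fix P Q assume PQ: "(P, Q) \<in> graph_polys G" "poly P y = 0"
  have "coeff P i \<in> fst ` G" for i
    using PQ(1) by (intro image_eqI[of _ _ "(coeff P i, coeff Q i)"]) (auto simp: graph_polys_def)
  then have "P = 0" using tr PQ(2) by blast
  moreover from this have "Q = 0" using graph_polys_0D[OF G] PQ(1) by simp
  ultimately show "dual_value y b P Q = 0" by (simp add: dual_value_def)
qed

text \<open>If \<open>y\<close> is algebraic, the value of the derivation at \<open>y\<close> is forced by a polynomial \<open>P0\<close> of
  minimal degree that vanishes at \<open>y\<close>.\<close>

lemma derivation_graph_adjoin_algebraic:
  assumes G: "derivation_graph G"
    and alg: "\<exists>P. (\<forall>i. coeff P i \<in> fst ` G) \<and> poly P y = 0 \<and> P \<noteq> 0"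
  shows "\<exists>b. derivation_graph (adjoin G y b)"
proof -
  define S where "S = {P. (\<exists>Q. (P, Q) \<in> graph_polys G) \<and> poly P y = 0 \<and> P \<noteq> 0}"
  obtain P where P: "\<forall>i. coeff P i \<in> fst ` G" "poly P y = 0" "P \<noteq> 0" using alg by blast
  then have "\<forall>i. \<exists>a. (coeff P i, a) \<in> G" by (metis imageE prod.collapse)
  then obtain q where q: "(coeff P i, q i) \<in> G" for i by metis
  \<comment> \<open>The chosen derivatives of the coefficients have finite support, as 0 can only
    have derivative 0; hence they are the coefficients of a polynomial.\<close>
  have "q i = 0" if "i > degree P" for i
    using q[of i] that derivation_graph_0D[OF G] by (simp add: coeff_eq_0)
  then have "coeff (Abs_poly q) = q"
    by (intro Abs_poly_inverse) (auto simp: MOST_nat)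
  then have "(P, Abs_poly q) \<in> graph_polys G" using q by (simp add: graph_polys_def)
  then have "P \<in> S" using P by (auto simp: S_def)
  then obtain P0 where P0: "P0 \<in> S" and min: "\<And>P. P \<in> S \<Longrightarrow> degree P0 \<le> degree P"
    using ex_has_least_nat[of "\<lambda>P. P \<in> S" P degree] by blast
  then obtain Q0 where Q0: "(P0, Q0) \<in> graph_polys G" "poly P0 y = 0" "P0 \<noteq> 0" by (auto simp: S_def)
  \<comment> \<open>Separability in characteristic 0: otherwise \<open>pderiv P0\<close> would be a
    nonzero member of \<open>S\<close> of smaller degree.\<close>
  have der: "poly (pderiv P0) y \<noteq> 0"
  proof
    assume d: "poly (pderiv P0) y = 0"
    have "degree P0 \<noteq> 0"
    proof
      assume "degree P0 = 0"
      then obtain c where "P0 = [:c:]" by (rule degree_eq_zeroE)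
      then show False using Q0(2,3) by simp
    qed
    then have nz: "pderiv P0 \<noteq> 0" by (simp add: pderiv_eq_0_iff)
    have nat: "(real n, 0) \<in> G" for n
      by (induction n) (use derivation_graph_add[OF G derivation_graph_1[OF G]] derivation_graph_0[OF G] in auto)
    have "(coeff (pderiv P0) i, coeff (pderiv Q0) i) \<in> G" for i
      using derivation_graph_mult[OF G nat[of "Suc i"], of "coeff P0 (Suc i)" "coeff Q0 (Suc i)"] Q0(1)
      by (simp add: coeff_pderiv graph_polys_def)
    then have "pderiv P0 \<in> S" using nz d unfolding S_def graph_polys_def by blast
    from min[OF this] show False using \<open>degree P0 \<noteq> 0\<close> by (simp add: degree_pderiv)
  qed
  define b where "b = - poly Q0 y / poly (pderiv P0) y"
  have b0: "dual_value y b P0 Q0 = 0" using der by (simp add: dual_value_def b_def)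
  have "dual_value y b P Q = 0" if "(P, Q) \<in> graph_polys G" "poly P y = 0" for P Q
    using that
  proof (induction "degree P" arbitrary: P Q rule: less_induct)
    case less
    show ?case
    proof (cases "P = 0")
      case True
      moreover from this have "Q = 0" using graph_polys_0D[OF G] less.prems(1) by simp
      ultimately show ?thesis by (simp add: dual_value_def)
    next
      case False
      then have le: "degree P0 \<le> degree P" using less.prems by (intro min) (auto simp: S_def)
      \<comment> \<open>One step of pseudo-division by \<open>P0\<close>: multiplying by leading
        coefficients cancels the top term without dividing in the ring. The second components of
        \<open>M\<close>, \<open>C\<close> and \<open>T\<close> carry the derivative along.\<close>
      define n where "n = degree P - degree P0"
      define M where "M = (monom (lead_coeff P) n, monom (coeff Q (degree P)) n)"
      define C where "C = (monom (lead_coeff P0) 0, monom (coeff Q0 (degree P0)) 0)"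
      have M: "M \<in> graph_polys G" unfolding M_def
        using less.prems(1) by (intro graph_polys_monom[OF G]) (auto simp: graph_polys_def)
      have C: "C \<in> graph_polys G" unfolding C_def
        using Q0(1) by (intro graph_polys_monom[OF G]) (auto simp: graph_polys_def)
      define R where "R = fst C * P - fst M * P0"
      define T where "T = (fst C * Q + snd C * P) - (fst M * Q0 + snd M * P0)"
      have RT: "(R, T) \<in> graph_polys G"
        unfolding R_def T_def
        using M C less.prems(1) Q0(1) by (intro graph_polys_diff graph_polys_mult G) simp_all
      have Ry: "poly R y = 0" by (simp add: R_def less.prems Q0)
      have val: "dual_value y b R T = lead_coeff P0 * dual_value y b P Q"
        unfolding R_def T_def dual_value_diff dual_value_mult
        by (simp add: less.prems Q0 b0 C_def poly_monom)
      show ?thesis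
      proof (cases "R = 0")
        case True
        moreover from this have "T = 0" using graph_polys_0D[OF G] RT by simp
        ultimately have "dual_value y b R T = 0" by (simp add: dual_value_def)
        then show ?thesis using val Q0(3) by simp
      next
        case False
        have "degree R < degree P"
        proof (rule ccontr)
          assume *: "\<not> degree R < degree P"
          have "degree R \<le> degree P" unfolding R_def
          proof (rule degree_diff_le)
            show "degree (fst C * P) \<le> degree P"
              using degree_mult_le[of "fst C" P] degree_monom_le[of "lead_coeff P0" 0] by (simp add: C_def)
            show "degree (fst M * P0) \<le> degree P"
              using degree_mult_le[of "fst M" P0] degree_monom_le[of "lead_coeff P" n] le
              by (simp add: M_def n_def)
          qed
          moreover have "coeff R (degree P) = 0"
            using le by (simp add: R_def C_def M_def coeff_monom_mult n_def)
          ultimately have "lead_coeff R = 0" using * by simp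
          then show False using False by simp
        qed
        from less.hyps[OF this RT Ry] show ?thesis using val Q0(3) by simp
      qed
    qed
  qed
  then show ?thesis using derivation_graph_adjoin[OF G] by blast
qed

text \<open>Zorn's lemma: a maximal graph is defined at every real, since any real can be adjoined,
  with an arbitrary value if transcendental and a forced one if algebraic. Inverses are covered by
  the algebraic case, 1/x being a root of xT - 1.\<close>

lemma derivation_extends:
  assumes "derivation_graph G"
  shows "\<exists>D. derivation D \<and> (\<forall>(x, a)\<in>G. D x = a)"
proof -
  define \<A> where "\<A> = {H. derivation_graph H \<and> G \<subseteq> H}"
  have "\<exists>M\<in>\<A>. \<forall>X\<in>\<A>. M \<subseteq> X \<longrightarrow> X = M"
  proof (rule subset_Zorn_nonempty)
    show "\<A> \<noteq> {}" using assms by (auto simp: \<A>_def)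
    fix \<C> assume ne: "\<C> \<noteq> {}" and ch: "subset.chain \<A> \<C>"
    have dg: "derivation_graph H" "G \<subseteq> H" if "H \<in> \<C>" for H
      using ch that by (auto simp: subset.chain_def \<A>_def)
    have "derivation_graph (\<Union>\<C>)"
      unfolding derivation_graph_def
    proof (intro conjI allI impI)
      obtain H where "H \<in> \<C>" using ne by blast
      then show "(1, 0) \<in> \<Union>\<C>" using derivation_graph_1[OF dg(1)] by blast
      show "a = 0" if "(0, a) \<in> \<Union>\<C>" for a using that derivation_graph_0D[OF dg(1)] by blast
      fix x a y b assume "(x, a) \<in> \<Union>\<C>" "(y, b) \<in> \<Union>\<C>"
      then obtain H K where HK: "H \<in> \<C>" "K \<in> \<C>" "(x, a) \<in> H" "(y, b) \<in> K" by blast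
      have "H \<subseteq> K \<or> K \<subseteq> H" using subset.chain_total[OF ch HK(1,2)] by auto
      then obtain L where "L \<in> \<C>" "(x, a) \<in> L" "(y, b) \<in> L" using HK by blast
      moreover from this have "(x - y, a - b) \<in> L" "(x * y, x * b + a * y) \<in> L"
        using derivation_graph_diff[OF dg(1)] derivation_graph_mult[OF dg(1)] by auto
      ultimately show "(x - y, a - b) \<in> \<Union>\<C>" "(x * y, x * b + a * y) \<in> \<Union>\<C>" by blast+
    qed
    then show "\<Union>\<C> \<in> \<A>" using ne dg by (auto simp: \<A>_def)
  qed
  then obtain M where MA: "M \<in> \<A>" and maxA: "\<forall>X\<in>\<A>. M \<subseteq> X \<longrightarrow> X = M" by (elim bexE)
  have M: "derivation_graph M" "G \<subseteq> M" using MA by (auto simp: \<A>_def)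
  have max: "X = M" if "derivation_graph X" "M \<subseteq> X" for X
    using maxA that M(2) unfolding \<A>_def by simp
  have total: "\<exists>b. (y, b) \<in> M" for y
  proof -
    have "\<exists>b. derivation_graph (adjoin M y b)"
    proof (cases "\<exists>P. (\<forall>i. coeff P i \<in> fst ` M) \<and> poly P y = 0 \<and> P \<noteq> 0")
      case True
      then show ?thesis by (rule derivation_graph_adjoin_algebraic[OF M(1)])
    next
      case False
      then have "derivation_graph (adjoin M y 0)"
        by (intro derivation_graph_adjoin_transcendental[OF M(1)]) blast
      then show ?thesis ..
    qed
    then obtain b where "derivation_graph (adjoin M y b)" ..
    from max[OF this adjoin_contains(1)[OF M(1)]] adjoin_contains(2)[OF M(1), of y b]
    show ?thesis by auto
  qed
  then obtain D where D: "(y, D y) \<in> M" for y by metis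
  have eq: "D y = b" if "(y, b) \<in> M" for y b
    using derivation_graph_unique[OF M(1) D that] .
  have "derivation D"
    unfolding derivation_def
    using eq derivation_graph_add[OF M(1) D D] derivation_graph_mult[OF M(1) D D] by auto
  moreover have "\<forall>(x, a)\<in>G. D x = a" using eq M(2) by auto
  ultimately show ?thesis by blast
qed

section \<open>Derivations prescribed on a generic realization\<close>

text \<open>On the ring of values \<open>f p\<close> of polynomial functions, take the directional
  derivative of \<open>f\<close> along \<open>x\<close>. This depends only on the number
  \<open>f p\<close>, because by genericity \<open>f p\<close> determines \<open>f\<close>; then
  extend to all reals.\<close>

lemma generic_derivation:
  fixes p x :: "'a \<Rightarrow> real ^ 'd::finite"
  assumes "generic V p"
  shows "\<exists>D. derivation D \<and> (\<forall>v\<in>V. \<forall>i. D (p v $ i) = x v $ i)"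
proof -
  define F where "F f c \<longleftrightarrow> poly_fun V f \<and>
      ((\<lambda>t. f (\<lambda>v. p v + t *\<^sub>R x v)) has_real_derivative c) (at 0)" for f c
  define G where "G = {(f p, c) |f c. F f c}"
  have "derivation_graph G"
    unfolding derivation_graph_def
  proof (intro conjI allI impI)
    have "F (\<lambda>_. 1) 0" by (auto simp: F_def)
    then show "(1, 0) \<in> G" by (force simp: G_def)
    show "a = 0" if "(0, a) \<in> G" for a
    proof -
      have "\<exists>f. F f a \<and> 0 = f p" using that unfolding G_def by blast
      then obtain f where f: "F f a" "0 = f p" by blast
      have "f q = 0" for q using f by (intro generic_poly_fun_zero[of V p f q] assms) (simp_all add: F_def)
      then have "((\<lambda>t. 0) has_real_derivative a) (at 0)" using f(1) by (simp add: F_def)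
      then show ?thesis using DERIV_unique[OF _ DERIV_const] by blast
    qed
    fix y a z b assume "(y, a) \<in> G" "(z, b) \<in> G"
    then obtain f g where fg: "F f a" "F g b" "y = f p" "z = g p" by (auto simp: G_def)
    have "F (\<lambda>p. f p - g p) (a - b)"
      using fg(1,2) by (auto simp: F_def intro: DERIV_diff)
    then show "(y - z, a - b) \<in> G" using fg by (force simp: G_def)
    have "F (\<lambda>p. f p * g p) (f p * b + a * g p)"
      using fg(1,2) unfolding F_def
      by (auto intro!: poly_fun.mult derivative_eq_intros simp: algebra_simps)
    then show "(y * z, y * b + a * z) \<in> G" using fg by (force simp: G_def)
  qed
  from derivation_extends[OF this] obtain D where D: "derivation D" "\<forall>(y, a)\<in>G. D y = a" by blast
  have "D (p v $ i) = x v $ i" if "v \<in> V" for v i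
  proof -
    have "F (\<lambda>p. p v $ i) (x v $ i)"
      unfolding F_def using that by (simp add: poly_fun.coord) (auto intro!: derivative_eq_intros)
    then have "(p v $ i, x v $ i) \<in> G" by (force simp: G_def)
    from bspec[OF D(2) this] show ?thesis by simp
  qed
  then show ?thesis using D(1) by blast
qed

definition vec_map :: "(real \<Rightarrow> real) \<Rightarrow> real ^ 'd \<Rightarrow> real ^ 'd" where
  "vec_map D x = (\<chi> i. D (x $ i))"

lemma derivation_add: "derivation D \<Longrightarrow> D (x + y) = D x + D y"
  and derivation_mult: "derivation D \<Longrightarrow> D (x * y) = x * D y + D x * y"
  by (auto simp: derivation_def)

lemma derivation_0: "derivation D \<Longrightarrow> D 0 = 0"
  using derivation_add[of D 0 0] by simp

lemma derivation_diff: "derivation D \<Longrightarrow> D (x - y) = D x - D y"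
  using derivation_add[of D "x - y" y] by simp

lemma derivation_sum: "derivation D \<Longrightarrow> D (sum f A) = (\<Sum>a\<in>A. D (f a))"
  by (induction A rule: infinite_finite_induct) (auto simp: derivation_0 derivation_add)

lemma derivation_double: "derivation D \<Longrightarrow> D (2 * x) = 2 * D x"
  using derivation_add[of D x x] by simp

lemma derivation_inner:
  "derivation D \<Longrightarrow> D (x \<bullet> y) = x \<bullet> vec_map D y + vec_map D x \<bullet> y"
  by (simp add: inner_vec_def vec_map_def derivation_sum derivation_mult sum.distrib)

lemma vec_map_diff: "derivation D \<Longrightarrow> vec_map D (x - y) = vec_map D x - vec_map D y"
  by (simp add: vec_eq_iff vec_map_def derivation_diff)

section \<open>Bars and infinitesimal rigidity\<close>

text \<open>The operation \<open>comb x c y\<close> plays the role of \<open>x + c y\<close>: realizations form no instance of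
  \<^class>\<open>real_vector\<close>.\<close>

lemma functional_in_span:
  fixes r :: "'k \<Rightarrow> 'x \<Rightarrow> real"
  assumes "finite F" "\<And>k x c y. k \<in> F \<Longrightarrow> r k (comb x c y) = r k x + c * r k y"
    and "\<And>x c y. f (comb x c y) = f x + c * f y"
    and "\<And>x. \<forall>k\<in>F. r k x = 0 \<Longrightarrow> f x = 0"
  shows "\<exists>c. \<forall>x. f x = (\<Sum>k\<in>F. c k * r k x)"
  using assms
proof (induction F arbitrary: f rule: finite_induct)
  case empty
  then show ?case by simp
next
  case (insert g F)
  have ext: "(\<Sum>k\<in>insert g F. (c(g := a)) k * r k x) = a * r g x + (\<Sum>k\<in>F. c k * r k x)" for c a x
  proof -
    have "(\<Sum>k\<in>F. (c(g := a)) k * r k x) = (\<Sum>k\<in>F. c k * r k x)"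
      using insert.hyps by (intro sum.cong) auto
    then show ?thesis using insert.hyps by simp
  qed
  show ?case
  proof (cases "\<forall>x. (\<forall>k\<in>F. r k x = 0) \<longrightarrow> r g x = 0")
    case True
    have "\<exists>c. \<forall>x. f x = (\<Sum>k\<in>F. c k * r k x)"
      using insert.prems True by (intro insert.IH) auto
    then obtain c where "\<And>x. f x = (\<Sum>k\<in>F. c k * r k x)" by blast
    then show ?thesis using ext[of c 0] by (intro exI[of _ "c(g := 0)"]) simp
  next
    case False
    then obtain y where y: "\<forall>k\<in>F. r k y = 0" "r g y \<noteq> 0" by blast
    \<comment> \<open>Subtracting this multiple of \<open>r g\<close> makes the functional vanish at
      \<open>y\<close>. A point where only the rows in \<open>F\<close> vanish can be shifted along
      \<open>y\<close> until \<open>r g\<close> vanishes too.\<close>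
    have "\<exists>c. \<forall>x. f x - f y / r g y * r g x = (\<Sum>k\<in>F. c k * r k x)"
    proof (rule insert.IH)
      show "r k (comb x c z) = r k x + c * r k z" if "k \<in> F" for k x c z
        using that insert.prems by simp
      show "f (comb x c z) - f y / r g y * r g (comb x c z) =
          f x - f y / r g y * r g x + c * (f z - f y / r g y * r g z)" for x c z
        using insert.prems(1)[of g] insert.prems(2) by (simp add: algebra_simps)
      fix x assume x: "\<forall>k\<in>F. r k x = 0"
      have "f (comb x (- (r g x / r g y)) y) = 0"
        using x y insert.prems(1) by (intro insert.prems(3)) auto
      then show "f x - f y / r g y * r g x = 0"
        using insert.prems(2) by (simp add: field_simps)
    qed
    then obtain c where c: "\<forall>x. f x - f y / r g y * r g x = (\<Sum>k\<in>F. c k * r k x)" ..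
    show ?thesis
    proof (intro exI allI)
      show "f x = (\<Sum>k\<in>insert g F. (c(g := f y / r g y)) k * r k x)" for x
        unfolding ext using spec[OF c, of x] by linarith
    qed
  qed
qed

text \<open>On an edge \<open>e = {u, w}\<close> the form \<open>bar e\<close> is \<open>2 (p u - p w) \<bullet> (x u - x w)\<close>; writing it as a
  sum over \<open>e \<times> e\<close> avoids choosing an orientation. Its diagonal is twice the squared length, and
  \<open>bar e p\<close> is a multiple of the row of the rigidity matrix at \<open>p\<close> that belongs to \<open>e\<close>.\<close>

definition bar :: "'a set \<Rightarrow> ('a \<Rightarrow> real ^ 'd::finite) \<Rightarrow> ('a \<Rightarrow> real ^ 'd) \<Rightarrow> real" where
  "bar e p x = (\<Sum>u\<in>e. \<Sum>w\<in>e. (p u - p w) \<bullet> (x u - x w))"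

lemma bar_pair: "bar {u, w} p x = 2 * ((p u - p w) \<bullet> (x u - x w))"
proof (cases "u = w")
  case False
  then have "bar {u, w} p x = (p u - p w) \<bullet> (x u - x w) + (p w - p u) \<bullet> (x w - x u)"
    by (simp add: bar_def)
  also have "(p w - p u) \<bullet> (x w - x u) = (p u - p w) \<bullet> (x u - x w)"
    by (metis inner_minus_left inner_minus_right minus_diff_eq minus_minus)
  finally show ?thesis by simp
qed (simp add: bar_def)

lemma bar_pair_norm: "bar {u, w} p p = 2 * (norm (p u - p w))\<^sup>2"
  by (simp add: bar_pair power2_norm_eq_inner)

lemma bar_pair_eq_iff: "bar {u, w} p p = bar {u, w} q q \<longleftrightarrow> norm (p u - p w) = norm (q u - q w)"
  by (simp add: bar_pair_norm)

lemma bar_commute: "bar e p x = bar e x p"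
  by (simp add: bar_def inner_commute)

lemma bar_linear: "bar e p (\<lambda>v. x v + c *\<^sub>R y v) = bar e p x + c * bar e p y"
proof -
  have "(p u - p w) \<bullet> ((x u + c *\<^sub>R y u) - (x w + c *\<^sub>R y w)) =
      (p u - p w) \<bullet> (x u - x w) + c * ((p u - p w) \<bullet> (y u - y w))" for u w
    by (simp add: inner_diff_right inner_add_right algebra_simps)
  then show ?thesis by (simp add: bar_def sum.distrib sum_distrib_left)
qed

lemma bar_linear_left: "bar e (\<lambda>v. x v + c *\<^sub>R y v) p = bar e x p + c * bar e y p"
proof -
  have "bar e z p = bar e p z" for z by (rule bar_commute)
  then show ?thesis by (simp only: bar_linear)
qed

lemma bar_add_scaled:
  "bar e (\<lambda>v. p v + c *\<^sub>R x v) (\<lambda>v. p v + c *\<^sub>R x v) = bar e p p + 2 * c * bar e p x + c\<^sup>2 * bar e x x"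
  by (simp add: bar_linear bar_linear_left bar_commute[of e x p] power2_eq_square algebra_simps)

lemma bar_zero_right [simp]: "bar e p (\<lambda>v. 0) = 0"
  by (simp add: bar_def)

lemma bar_sum: "bar e p (\<lambda>v. \<Sum>k\<in>K. c k *\<^sub>R x k v) = (\<Sum>k\<in>K. c k * bar e p (x k))"
proof (induction K rule: infinite_finite_induct)
  case (insert k K)
  then show ?case using bar_linear[of e p "\<lambda>v. \<Sum>k\<in>K. c k *\<^sub>R x k v" "c k" "x k"] by (simp add: add.commute)
qed auto

lemma bar_cong:
  assumes "\<And>v. v \<in> e \<Longrightarrow> p v = q v" "\<And>v. v \<in> e \<Longrightarrow> x v = y v"
  shows "bar e p x = bar e q y"
  unfolding bar_def using assms by (intro sum.cong) auto

text \<open>A derivation thus moves the framework with velocities \<open>vec_map D (p v)\<close>,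
  and a bar whose squared length it annihilates is not stretched to first order.\<close>

lemma derivation_bar:
  assumes "derivation D"
  shows "D (bar e p p) = 2 * bar e p (\<lambda>v. vec_map D (p v))"
proof -
  have "D ((p u - p w) \<bullet> (p u - p w)) = 2 * ((p u - p w) \<bullet> (vec_map D (p u) - vec_map D (p w)))" for u w
    by (simp add: derivation_inner[OF assms] vec_map_diff[OF assms] inner_commute)
  then show ?thesis by (simp add: bar_def derivation_sum[OF assms] sum_distrib_left)
qed

lemma poly_fun_bar:
  assumes "e \<subseteq> V"
  shows "poly_fun V (\<lambda>q. bar e q q)"
  unfolding bar_def inner_vec_def inner_real_def vector_minus_component using assms
  by (intro poly_fun_sum poly_fun.mult poly_fun_diff poly_fun.coord) auto

text \<open>The standard basis of the space of motions. The numbers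
  \<open>bar e p (unit_motion j)\<close> are the entries of the rigidity matrix up to the factor 2,
  so its rank falls under the polynomial rank lemma.\<close>

definition unit_motion :: "'a \<times> 'd \<Rightarrow> 'a \<Rightarrow> real ^ 'd::finite" where
  "unit_motion j u = (if u = fst j then axis (snd j) 1 else 0)"

lemma poly_fun_bar_unit:
  assumes "e \<subseteq> V"
  shows "poly_fun V (\<lambda>q. bar e q (unit_motion j))"
proof -
  define c where "c u i = (if u = fst j \<and> i = snd j then 1 else 0 :: rat)" for u i
  have c: "unit_motion j u $ i - unit_motion j w $ i = of_rat (c u i - c w i)" for u w i
    by (auto simp: unit_motion_def axis_def of_rat_diff c_def)
  show ?thesis
    unfolding bar_def inner_vec_def inner_real_def vector_minus_component c using assms
    by (intro poly_fun_sum poly_fun.mult poly_fun_diff poly_fun.coord poly_fun.const) auto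
qed

lemma bar_unit_expand:
  assumes "finite V" "e \<subseteq> V"
  shows "bar e p x = (\<Sum>j\<in>V \<times> UNIV. (x (fst j) $ snd j) * bar e p (unit_motion j))"
proof -
  have "(\<Sum>j\<in>V \<times> UNIV. (x (fst j) $ snd j) *\<^sub>R unit_motion j v) = x v" if "v \<in> V" for v
  proof -
    have "(\<Sum>j\<in>V \<times> UNIV. (x (fst j) $ snd j) *\<^sub>R unit_motion j v) =
        (\<Sum>u\<in>V. \<Sum>i\<in>UNIV. (x u $ i) *\<^sub>R unit_motion (u, i) v)"
      by (simp add: sum.cartesian_product case_prod_unfold)
    also have "\<dots> = (\<Sum>u\<in>V. if v = u then x v else 0)"
    proof (rule sum.cong[OF refl])
      fix u
      have "(\<Sum>i\<in>UNIV. (x v $ i) *\<^sub>R axis i (1::real)) = x v"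
        by (simp add: vec_eq_iff axis_def if_distrib cong: if_cong)
      then show "(\<Sum>i\<in>UNIV. (x u $ i) *\<^sub>R unit_motion (u, i) v) = (if v = u then x v else 0)"
        by (auto simp: unit_motion_def)
    qed
    also have "\<dots> = x v" using assms(1) that by simp
    finally show ?thesis .
  qed
  then have "bar e p x = bar e p (\<lambda>v. \<Sum>j\<in>V \<times> UNIV. (x (fst j) $ snd j) *\<^sub>R unit_motion j v)"
    using assms(2) by (intro bar_cong) auto
  then show ?thesis by (simp add: bar_sum)
qed

section \<open>Stresses, infinitesimal rigidity and their transfer between realizations\<close>

text \<open>\<open>F\<close> carries no nonzero stress; equilibrium at the vertices is tested
  against all motions at once.\<close>

definition bar_independent :: "'a set set \<Rightarrow> ('a \<Rightarrow> real ^ 'd::finite) \<Rightarrow> bool" where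
  "bar_independent F p \<longleftrightarrow>
     (\<forall>c. (\<forall>x. (\<Sum>e\<in>F. c e * bar e p x) = 0) \<longrightarrow> (\<forall>e\<in>F. c e = 0))"

text \<open>Stated through pairs of vertices instead of a rank: a rank formula would have to treat
  vertex sets with few points separately.\<close>

definition infinitesimally_rigid :: "'a set \<Rightarrow> 'a set set \<Rightarrow> ('a \<Rightarrow> real ^ 'd::finite) \<Rightarrow> bool" where
  "infinitesimally_rigid V E p \<longleftrightarrow>
     (\<forall>x. (\<forall>e\<in>E. bar e p x = 0) \<longrightarrow> (\<forall>u\<in>V. \<forall>w\<in>V. bar {u, w} p x = 0))"

lemma bar_independent_generic:
  fixes p q :: "'a \<Rightarrow> real ^ 'd::finite"
  assumes V: "finite V" "finite F" "\<And>e. e \<in> F \<Longrightarrow> e \<subseteq> V"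
    and q: "bar_independent F q" and p: "generic V p"
  shows "bar_independent F p"
  unfolding bar_independent_def
proof (intro allI impI ballI)
  fix c e assume c: "\<forall>x. (\<Sum>e\<in>F. c e * bar e p x) = 0" and e: "e \<in> F"
  show "c e = 0"
  proof (rule rows_independent_generic[where J = "V \<times> UNIV" and r = "\<lambda>e j q. bar e q (unit_motion j)"
        and F = F and V = V and ?q0.0 = q and p = p])
    show "poly_fun V (\<lambda>q. bar e q (unit_motion j))" if "e \<in> F" for e j
      using V(3)[OF that] by (rule poly_fun_bar_unit)
    fix c e assume c: "\<forall>j\<in>V \<times> UNIV. (\<Sum>e\<in>F. c e * bar e q (unit_motion j)) = 0" and e: "e \<in> F"
    have "(\<Sum>e\<in>F. c e * bar e q x) = 0" for x
    proof -
      have "(\<Sum>e\<in>F. c e * bar e q x) =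
          (\<Sum>e\<in>F. \<Sum>j\<in>V \<times> UNIV. c e * ((x (fst j) $ snd j) * bar e q (unit_motion j)))"
        using V by (intro sum.cong) (simp_all add: bar_unit_expand[of V _ q x] sum_distrib_left)
      also have "\<dots> = (\<Sum>j\<in>V \<times> UNIV. (x (fst j) $ snd j) * (\<Sum>e\<in>F. c e * bar e q (unit_motion j)))"
        by (subst sum.swap) (simp add: sum_distrib_left algebra_simps)
      finally show ?thesis using c by simp
    qed
    then show "c e = 0" using q e unfolding bar_independent_def by blast
  qed (use V p c e in auto)
qed

lemma bar_dependent_insert:
  assumes "finite F" "bar_independent F p" "e \<notin> F" "\<not> bar_independent (insert e F) p"
  shows "\<exists>c. \<forall>x. bar e p x = (\<Sum>f\<in>F. c f * bar f p x)"
proof -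
  obtain c where c: "\<And>x. (\<Sum>f\<in>insert e F. c f * bar f p x) = 0" "\<exists>f\<in>insert e F. c f \<noteq> 0"
    using assms(4) unfolding bar_independent_def by blast
  have e: "c e * bar e p x + (\<Sum>f\<in>F. c f * bar f p x) = 0" for x
    using c(1) assms(1,3) by simp
  have "c e \<noteq> 0"
  proof
    assume "c e = 0"
    then have "\<forall>f\<in>F. c f = 0" using e assms(2) unfolding bar_independent_def by simp
    then show False using c(2) \<open>c e = 0\<close> by simp
  qed
  have "bar e p x = (\<Sum>f\<in>F. (- c f / c e) * bar f p x)" for x
  proof -
    have "(\<Sum>f\<in>F. (- c f / c e) * bar f p x) = (- 1 / c e) * (\<Sum>f\<in>F. c f * bar f p x)"
      by (simp only: sum_distrib_left) (simp add: mult.assoc[symmetric])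
    also have "\<dots> = (- 1 / c e) * (- c e * bar e p x)"
      using e[of x] by (metis add_eq_0_iff mult_minus_left)
    finally show ?thesis using \<open>c e \<noteq> 0\<close> by simp
  qed
  then show ?thesis by (intro exI[of _ "\<lambda>f. - c f / c e"] allI)
qed

lemma bar_in_span:
  assumes "finite F" "\<And>x. \<forall>f\<in>F. bar f p x = 0 \<Longrightarrow> bar e p x = 0"
  shows "\<exists>c. \<forall>x. bar e p x = (\<Sum>f\<in>F. c f * bar f p x)"
  by (rule functional_in_span[where comb = "\<lambda>x c y v. x v + c *\<^sub>R y v"])
    (use assms in \<open>auto simp: bar_linear\<close>)

lemma bar_independent_insert:
  assumes "finite F" "bar_independent F p" "\<forall>f\<in>F. bar f p x = 0" "bar e p x \<noteq> 0"
  shows "bar_independent (insert e F) p"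
proof (rule ccontr)
  assume "\<not> bar_independent (insert e F) p"
  moreover have "e \<notin> F" using assms by blast
  ultimately obtain c where "\<And>x. bar e p x = (\<Sum>f\<in>F. c f * bar f p x)"
    using bar_dependent_insert assms by blast
  then show False using assms by simp
qed

lemma maximal_bar_independent:
  assumes "finite E"
  obtains F where "F \<subseteq> E" "bar_independent F p" "\<And>e x. e \<in> E \<Longrightarrow> \<forall>f\<in>F. bar f p x = 0 \<Longrightarrow> bar e p x = 0"
proof -
  let ?S = "{F. F \<subseteq> E \<and> bar_independent F p}"
  have "finite ?S" using assms by simp
  moreover have "{} \<in> ?S" by (simp add: bar_independent_def)
  ultimately have "\<exists>F\<in>?S. \<forall>G\<in>?S. F \<subseteq> G \<longrightarrow> F = G"
    using finite_has_maximal[of ?S] by blast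
  then obtain F where F: "F \<in> ?S" "\<forall>G\<in>?S. F \<subseteq> G \<longrightarrow> F = G" ..
  have "bar e p x = 0" if "e \<in> E" "\<forall>f\<in>F. bar f p x = 0" for e x
  proof (rule ccontr)
    assume ne: "bar e p x \<noteq> 0"
    have "finite F" using F(1) assms finite_subset by blast
    then have "bar_independent (insert e F) p" using bar_independent_insert F(1) that(2) ne by blast
    then have "insert e F \<in> ?S" using F(1) that(1) by simp
    then have "insert e F = F" using F(2) by blast
    then show False using that(2) ne by blast
  qed
  then show thesis using that F(1) by blast
qed

text \<open>Let \<open>F\<close> be a basis of the rows at \<open>p\<close>. If a motion of
  \<open>q\<close> preserving \<open>E\<close> to first order stretched \<open>{u, w}\<close>, then
  \<open>insert {u, w} F\<close> would be independent at \<open>q\<close>, hence at the generic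
  \<open>p\<close>. But rigidity at \<open>p\<close> puts the row of \<open>{u, w}\<close> into the
  span of \<open>F\<close>.\<close>

lemma infinitesimally_rigid_transfer:
  fixes p q :: "'a \<Rightarrow> real ^ 'd::finite"
  assumes V: "finite V" "finite E" "\<And>e. e \<in> E \<Longrightarrow> e \<subseteq> V" and p: "generic V p"
    and rigid: "infinitesimally_rigid V E p"
    and ind: "\<And>F. F \<subseteq> E \<Longrightarrow> bar_independent F p \<Longrightarrow> bar_independent F q"
  shows "infinitesimally_rigid V E q"
proof -
  obtain F where F: "F \<subseteq> E" "bar_independent F p"
    and max: "\<And>e x. e \<in> E \<Longrightarrow> \<forall>f\<in>F. bar f p x = 0 \<Longrightarrow> bar e p x = 0"
    using maximal_bar_independent[OF V(2)] by blast
  have finF: "finite F" using F(1) V(2) finite_subset by blast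
  show ?thesis
    unfolding infinitesimally_rigid_def
  proof (intro allI impI ballI)
    fix x u w assume x: "\<forall>e\<in>E. bar e q x = 0" and uw: "u \<in> V" "w \<in> V"
    show "bar {u, w} q x = 0"
    proof (rule ccontr)
      assume ne: "bar {u, w} q x \<noteq> 0"
      have Fq: "\<forall>f\<in>F. bar f q x = 0" using x F(1) by blast
      then have notin: "{u, w} \<notin> F" using ne by blast
      have iq: "bar_independent (insert {u, w} F) q"
        using bar_independent_insert[OF finF ind[OF F] Fq ne] .
      have ip: "bar_independent (insert {u, w} F) p"
      proof (rule bar_independent_generic[OF V(1) _ _ iq p])
        show "finite (insert {u, w} F)" using finF by simp
        show "e \<subseteq> V" if "e \<in> insert {u, w} F" for e
          using that uw F(1) V(3) by auto
      qed
      have "bar {u, w} p y = 0" if "\<forall>f\<in>F. bar f p y = 0" for y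
      proof -
        have "\<forall>e\<in>E. bar e p y = 0" using max that by auto
        then show ?thesis using rigid uw unfolding infinitesimally_rigid_def by simp
      qed
      from bar_in_span[OF finF this] obtain c
        where c: "\<forall>y. bar {u, w} p y = (\<Sum>f\<in>F. c f * bar f p y)" by blast
      define c' where "c' f = (if f = {u, w} then -1 else c f)" for f
      have "(\<Sum>f\<in>F. c' f * bar f p y) = (\<Sum>f\<in>F. c f * bar f p y)" for y
        using notin by (intro sum.cong) (auto simp: c'_def)
      then have "(\<Sum>f\<in>insert {u, w} F. c' f * bar f p y) = 0" for y
        using notin finF c by (simp add: c'_def[of "{u, w}"])
      then have "c' {u, w} = 0" using ip unfolding bar_independent_def by blast
      then show False by (simp add: c'_def)
    qed
  qed
qed

lemma infinitesimally_rigid_generic: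
  fixes p q :: "'a \<Rightarrow> real ^ 'd::finite"
  assumes V: "finite V" "finite E" "\<And>e. e \<in> E \<Longrightarrow> e \<subseteq> V"
    and p: "generic V p" "infinitesimally_rigid V E p" and q: "generic V q"
  shows "infinitesimally_rigid V E q"
proof (rule infinitesimally_rigid_transfer[OF V p])
  fix F assume "F \<subseteq> E" "bar_independent F p"
  then show "bar_independent F q"
    using V(2,3) finite_subset by (intro bar_independent_generic[OF V(1) _ _ _ q, of F p]) auto
qed

text \<open>A stress of \<open>q\<close> is a stress of \<open>p\<close>: apply derivations to the equal edge lengths, and note that
  a derivation can take arbitrary values on the coordinates of the generic realization \<open>p\<close>.\<close>

lemma bar_independent_equivalent:
  fixes p q :: "'a \<Rightarrow> real ^ 'd::finite"
  assumes V: "\<And>e. e \<in> F \<Longrightarrow> e \<subseteq> V" and p: "generic V p"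
    and eq: "\<And>e. e \<in> F \<Longrightarrow> bar e p p = bar e q q" and ind: "bar_independent F p"
  shows "bar_independent F q"
  unfolding bar_independent_def
proof (intro allI impI ballI)
  fix c e assume c: "\<forall>x. (\<Sum>e\<in>F. c e * bar e q x) = 0" and e: "e \<in> F"
  have "(\<Sum>e\<in>F. c e * bar e p x) = 0" for x
  proof -
    obtain D where D: "derivation D" "\<forall>v\<in>V. \<forall>i. D (p v $ i) = x v $ i"
      using generic_derivation[OF p, of x] by (elim exE conjE)
    have "bar e p x = bar e q (\<lambda>v. vec_map D (q v))" if "e \<in> F" for e
    proof -
      have "bar e p (\<lambda>v. vec_map D (p v)) = bar e q (\<lambda>v. vec_map D (q v))"
        using derivation_bar[OF D(1), of e p] derivation_bar[OF D(1), of e q] eq[OF that] by simp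
      moreover have "bar e p (\<lambda>v. vec_map D (p v)) = bar e p x"
        using D(2) V[OF that] by (intro bar_cong) (auto simp: vec_map_def vec_eq_iff)
      ultimately show ?thesis by simp
    qed
    then show ?thesis using c by simp
  qed
  then show "c e = 0" using ind e unfolding bar_independent_def by blast
qed

lemma infinitesimally_rigid_equivalent:
  fixes p q :: "'a \<Rightarrow> real ^ 'd::finite"
  assumes V: "finite V" "finite E" "\<And>e. e \<in> E \<Longrightarrow> e \<subseteq> V"
    and p: "generic V p" "infinitesimally_rigid V E p"
    and eq: "\<And>e. e \<in> E \<Longrightarrow> bar e p p = bar e q q"
  shows "infinitesimally_rigid V E q"
proof (rule infinitesimally_rigid_transfer[OF V p])
  fix F assume "F \<subseteq> E" "bar_independent F p"
  then show "bar_independent F q"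
    using V(3) eq bar_independent_equivalent[OF _ p(1), of F q] by (auto simp: subset_iff)
qed

text \<open>Tested at the realization that puts \<open>v\<close> at the origin and the points of
  \<open>N\<close> at distinct unit vectors.\<close>

lemma generic_affine_independent:
  fixes p :: "'a \<Rightarrow> real ^ 'd::finite"
  assumes "generic V p" "v \<in> V" "N \<subseteq> V - {v}" "finite N" "card N \<le> CARD('d)"
    and "(\<Sum>w\<in>N. c w *\<^sub>R (p w - p v)) = 0" "w \<in> N"
  shows "c w = 0"
proof -
  obtain t :: "'a \<Rightarrow> 'd" where t: "inj_on t N"
    using card_le_inj[of N "UNIV :: 'd set"] assms(4,5) by auto
  define q0 :: "'a \<Rightarrow> real ^ 'd" where "q0 u = (if u = v then 0 else axis (t u) 1)" for u
  show ?thesis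
  proof (rule rows_independent_generic[where J = UNIV and r = "\<lambda>w i q. (q w - q v) $ i"
        and F = N and V = V and ?q0.0 = q0 and p = p and k = w])
    show "poly_fun V (\<lambda>q. (q w - q v) $ i)" if "w \<in> N" for w i
      unfolding vector_minus_component using that assms(2,3)
      by (intro poly_fun_diff poly_fun.coord) auto
    show "\<forall>i\<in>UNIV. (\<Sum>w\<in>N. c w * (p w - p v) $ i) = 0"
      using assms(6) by (simp add: vec_eq_iff sum_component)
    fix c w assume c: "\<forall>i\<in>UNIV. (\<Sum>w\<in>N. c w * (q0 w - q0 v) $ i) = 0" and w: "w \<in> N"
    have "(\<Sum>u\<in>N. c u * (q0 u - q0 v) $ t w) = (\<Sum>u\<in>N. if u = w then c u else 0)"
    proof (rule sum.cong[OF refl])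
      fix u assume u: "u \<in> N"
      then have "u \<noteq> v" "t u = t w \<longleftrightarrow> u = w" using assms(3) t w by (auto simp: inj_on_eq_iff)
      then show "c u * (q0 u - q0 v) $ t w = (if u = w then c u else 0)"
        by (auto simp: q0_def axis_def)
    qed
    also have "\<dots> = c w" using assms(4) w by simp
    finally show "c w = 0" using c by simp
  qed (use assms in auto)
qed

section \<open>Rigid generic frameworks are infinitesimally rigid\<close>

text \<open>If the length of \<open>e\<close> were transcendental over the lengths of \<open>F\<close>, a derivation could move
  the former while fixing the latter.\<close>

lemma bar_finite_values:
  fixes p :: "'a \<Rightarrow> real ^ 'd::finite"
  assumes p: "generic V p" and V: "e \<subseteq> V" "\<And>f. f \<in> F \<Longrightarrow> f \<subseteq> V"
    and dep: "\<And>x. \<forall>f\<in>F. bar f p x = 0 \<Longrightarrow> bar e p x = 0"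
  shows "\<exists>Z. finite Z \<and> (\<forall>q :: 'a \<Rightarrow> real ^ 'd. (\<forall>f\<in>F. bar f q q = bar f p p) \<longrightarrow> bar e q q \<in> Z)"
proof -
  define fib where "fib q \<longleftrightarrow> (\<forall>f\<in>F. bar f q q = bar f p p)" for q :: "'a \<Rightarrow> real ^ 'd"
  \<comment> \<open>The polynomial functions that are constant on the fibre of the lengths of
    \<open>F\<close>. On the ring of their values at \<open>p\<close> the zero derivation is taken;
    \<open>G\<close> is its graph.\<close>
  define invar where "invar g \<longleftrightarrow> poly_fun V g \<and> (\<forall>q. fib q \<longrightarrow> g q = g p)" for g
  define G where "G = {(g p, 0 :: real) |g. invar g}"
  have inG: "(g p, 0) \<in> G" if "invar g" for g using that by (auto simp: G_def)
  have G: "derivation_graph G"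
    unfolding derivation_graph_def
  proof (intro conjI allI impI)
    show "(1, 0) \<in> G" using inG[of "\<lambda>_. 1"] by (auto simp: invar_def)
    show "a = 0" if "(0, a) \<in> G" for a using that by (auto simp: G_def)
    fix x a y b assume "(x, a) \<in> G" "(y, b) \<in> G"
    then have "\<exists>g h. invar g \<and> invar h \<and> x = g p \<and> y = h p \<and> a = 0 \<and> b = 0" unfolding G_def by blast
    then obtain g h where gh: "invar g" "invar h" and eqs: "x = g p" "y = h p" "a = 0" "b = 0" by blast
    have "invar (\<lambda>q. g q - h q)" "invar (\<lambda>q. g q * h q)"
      using gh by (auto simp: invar_def intro: poly_fun.mult)
    from inG[OF this(1)] inG[OF this(2)]
    show "(x - y, a - b) \<in> G" "(x * y, x * b + a * y) \<in> G" by (simp_all add: eqs)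
  qed
  have alg: "\<exists>P. (\<forall>i. coeff P i \<in> fst ` G) \<and> poly P (bar e p p) = 0 \<and> P \<noteq> 0"
  proof (rule ccontr)
    assume "\<not> (\<exists>P. (\<forall>i. coeff P i \<in> fst ` G) \<and> poly P (bar e p p) = 0 \<and> P \<noteq> 0)"
    then have "derivation_graph (adjoin G (bar e p p) 1)"
      by (intro derivation_graph_adjoin_transcendental[OF G]) blast
    then obtain D where D: "derivation D" "\<forall>(x, a)\<in>adjoin G (bar e p p) 1. D x = a"
      using derivation_extends by blast
    have "D (bar f p p) = 0" if "f \<in> F" for f
    proof -
      have "invar (\<lambda>q. bar f q q)" using that V(2) by (auto simp: invar_def fib_def intro: poly_fun_bar)
      from inG[OF this] have "(bar f p p, 0) \<in> adjoin G (bar e p p) 1"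
        using adjoin_contains(1)[OF G] by blast
      from bspec[OF D(2) this] show ?thesis by simp
    qed
    then have "bar e p (\<lambda>v. vec_map D (p v)) = 0"
      by (intro dep) (simp add: derivation_bar[OF D(1)])
    then have "D (bar e p p) = 0" by (simp add: derivation_bar[OF D(1)])
    moreover have "D (bar e p p) = 1"
      using bspec[OF D(2) adjoin_contains(2)[OF G]] by simp
    ultimately show False by simp
  qed
  then obtain P where P: "\<forall>i. coeff P i \<in> fst ` G" "poly P (bar e p p) = 0" "P \<noteq> 0"
    by (elim exE conjE)
  have "\<exists>g. invar g \<and> g p = coeff P i" for i
  proof -
    obtain z where "z \<in> G" "coeff P i = fst z" using P(1) by blast
    then show ?thesis by (auto simp: G_def)
  qed
  then obtain h where h: "\<forall>i. invar (h i) \<and> h i p = coeff P i" by metis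
  \<comment> \<open>Lift the coefficients of \<open>P\<close> to polynomial functions constant on
    the fibre. Genericity turns \<open>H p = 0\<close> into \<open>H q = 0\<close> for all
    \<open>q\<close>, and on the fibre this says that \<open>bar e q q\<close> is a root of
    \<open>P\<close>.\<close>
  define H where "H q = (\<Sum>i\<le>degree P. h i q * bar e q q ^ i)" for q
  have "poly_fun V H"
    unfolding H_def using h poly_fun_bar[OF V(1)]
    by (intro poly_fun_sum poly_fun.mult poly_fun_power) (auto simp: invar_def)
  moreover have "H p = 0" using P(2) h by (simp add: H_def poly_altdef)
  ultimately have H0: "H q = 0" for q by (rule generic_poly_fun_zero[OF p])
  have "poly P (bar e q q) = 0" if "fib q" for q
    using H0[of q] h that by (simp add: H_def poly_altdef invar_def)
  then show ?thesis
    using poly_roots_finite[OF P(3)] unfolding fib_def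
    by (intro exI[of _ "{z. poly P z = 0}"]) simp
qed

section \<open>Deformations along independent bars\<close>

lemma continuous_on_bar: "continuous_on S (\<lambda>q. bar e q q)"
  unfolding bar_def
  by (intro continuous_intros continuous_on_subset[OF continuous_on_product_coordinates]) auto

lemma bar_diff_bound:
  assumes "\<And>v. v \<in> e \<Longrightarrow> norm (q v - p v) \<le> r"
  shows "\<bar>bar e q x - bar e p x\<bar> \<le> r * (\<Sum>u\<in>e. \<Sum>w\<in>e. 2 * norm (x u - x w))"
proof -
  have "bar e q x - bar e p x = bar e (\<lambda>v. q v - p v) x"
    using bar_linear_left[of e q "-1" p x] by simp
  also have "\<bar>\<dots>\<bar> \<le> (\<Sum>u\<in>e. \<Sum>w\<in>e. \<bar>((q u - p u) - (q w - p w)) \<bullet> (x u - x w)\<bar>)"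
    unfolding bar_def by (intro order_trans[OF sum_abs] sum_mono) auto
  also have "\<dots> \<le> (\<Sum>u\<in>e. \<Sum>w\<in>e. 2 * r * norm (x u - x w))"
  proof (intro sum_mono)
    fix u w assume "u \<in> e" "w \<in> e"
    then have "norm ((q u - p u) - (q w - p w)) \<le> 2 * r"
      using norm_triangle_ineq4[of "q u - p u" "q w - p w"] assms[of u] assms[of w] by linarith
    then show "\<bar>((q u - p u) - (q w - p w)) \<bullet> (x u - x w)\<bar> \<le> 2 * r * norm (x u - x w)"
      using Cauchy_Schwarz_ineq2[of "(q u - p u) - (q w - p w)" "x u - x w"]
      by (meson mult_right_mono norm_ge_zero order_trans)
  qed
  also have "\<dots> = r * (\<Sum>u\<in>e. \<Sum>w\<in>e. 2 * norm (x u - x w))"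
    by (simp add: sum_distrib_left algebra_simps)
  finally show ?thesis .
qed

text \<open>By independence, row \<open>g\<close> is outside the span of the other rows, so some
  motion stretches \<open>g\<close> alone; it is then scaled. Vanishing outside \<open>V\<close>
  keeps realizations extensional when they are displaced along these motions.\<close>

lemma bar_dual_motions:
  assumes "finite H" "bar_independent H p" "\<And>e. e \<in> H \<Longrightarrow> e \<subseteq> V"
  shows "\<exists>x. (\<forall>g\<in>H. \<forall>e\<in>H. bar e p (x g) = (if e = g then 1 else 0)) \<and> (\<forall>g. \<forall>v. v \<notin> V \<longrightarrow> x g v = 0)"
proof -
  have "\<exists>y. (\<forall>e\<in>H. bar e p y = (if e = g then 1 else 0)) \<and> (\<forall>v. v \<notin> V \<longrightarrow> y v = 0)" if g: "g \<in> H" for g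
  proof -
    have "\<exists>z. (\<forall>e\<in>H - {g}. bar e p z = 0) \<and> bar g p z \<noteq> 0"
    proof (rule ccontr)
      assume "\<not> (\<exists>z. (\<forall>e\<in>H - {g}. bar e p z = 0) \<and> bar g p z \<noteq> 0)"
      then have "\<exists>c. \<forall>z. bar g p z = (\<Sum>e\<in>H - {g}. c e * bar e p z)"
        using assms(1) by (intro bar_in_span) auto
      then obtain c where c: "\<And>z. bar g p z = (\<Sum>e\<in>H - {g}. c e * bar e p z)" by (elim exE) auto
      have "(\<Sum>e\<in>H. (c(g := -1)) e * bar e p z) = 0" for z
      proof -
        have "(\<Sum>e\<in>H - {g}. (c(g := -1)) e * bar e p z) = (\<Sum>e\<in>H - {g}. c e * bar e p z)"
          by (intro sum.cong) auto
        then show ?thesis using c[of z] by (simp add: sum.remove[OF assms(1) g])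
      qed
      then have "(c(g := -1)) g = 0" using assms(2) g unfolding bar_independent_def by blast
      then show False by simp
    qed
    then obtain z where z: "\<forall>e\<in>H - {g}. bar e p z = 0" "bar g p z \<noteq> 0" by blast
    define y where "y v = (if v \<in> V then 0 + (1 / bar g p z) *\<^sub>R z v else 0)" for v
    have "bar e p y = 1 / bar g p z * bar e p z" if "e \<in> H" for e
    proof -
      have "bar e p y = bar e p (\<lambda>v. 0 + (1 / bar g p z) *\<^sub>R z v)"
        using assms(3)[OF that] by (intro bar_cong) (auto simp: y_def)
      also have "\<dots> = bar e p (\<lambda>v. 0) + 1 / bar g p z * bar e p z" by (rule bar_linear)
      finally show ?thesis by simp
    qed
    then show ?thesis using z by (intro exI[of _ y]) (auto simp: y_def)
  qed
  then have "\<forall>g. \<exists>y. g \<in> H \<longrightarrow> (\<forall>e\<in>H. bar e p y = (if e = g then 1 else 0)) \<and> (\<forall>v. v \<notin> V \<longrightarrow> y v = 0)"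
    by blast
  then obtain x where x: "\<forall>g. g \<in> H \<longrightarrow> (\<forall>e\<in>H. bar e p (x g) = (if e = g then 1 else 0)) \<and>
      (\<forall>v. v \<notin> V \<longrightarrow> x g v = 0)" by (rule choice[THEN exE])
  then show ?thesis
    by (intro exI[of _ "\<lambda>g v. if g \<in> H then x g v else 0"]) simp
qed

text \<open>Ekeland's variational principle on a compact ball: at a minimizer of
  \<open>|L q - t| + \<delta> |q - p|\<close> the lengths \<open>L q\<close> equal their targets \<open>t\<close>, since otherwise the dual
  motions yield a direction of steep descent.\<close>

lemma bar_independent_deformation:
  fixes p :: "'a \<Rightarrow> real ^ 'd::finite"
  assumes V: "finite V" "finite H" "\<And>e. e \<in> H \<Longrightarrow> e \<subseteq> V" and ind: "bar_independent H p"
    and p: "p \<in> realizations V" and \<rho>: "\<rho> > 0" and f: "f \<in> H"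
  shows "\<exists>q\<in>realizations V. (\<forall>v\<in>V. norm (q v - p v) < \<rho>) \<and>
    (\<forall>e\<in>H - {f}. bar e q q = bar e p p) \<and> bar f q q \<noteq> bar f p p"
proof -
  obtain x where x: "\<forall>g\<in>H. \<forall>e\<in>H. bar e p (x g) = (if e = g then 1 else 0)"
    and xV: "\<forall>g. \<forall>v. v \<notin> V \<longrightarrow> x g v = 0"
    using bar_dual_motions[OF V(2) ind V(3)] by blast
  define nrm where "nrm y = (\<Sum>v\<in>V. norm (y v))" for y :: "'a \<Rightarrow> real ^ 'd"
  \<comment> \<open>\<open>M - 1\<close> bounds the size of a combination of dual motions with
    coefficients in [-1, 1]; \<open>B\<close> controls how far these motions are from dual at a
    nearby realization.\<close>
  define M where "M = 1 + (\<Sum>g\<in>H. nrm (x g))"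
  define B where "B = (\<Sum>e\<in>H. \<Sum>g\<in>H. \<Sum>u\<in>e. \<Sum>w\<in>e. 2 * norm (x g u - x g w))"
  have "M \<ge> 1" by (simp add: M_def nrm_def sum_nonneg)
  have "B \<ge> 0" by (simp add: B_def sum_nonneg)
  define r where "r = min (\<rho> / 2) (1 / (2 * (B + 1)))"
  have r: "r > 0" "r < \<rho>" using \<rho> \<open>B \<ge> 0\<close> by (auto simp: r_def)
  have rB: "r * B \<le> 1 / 2"
  proof -
    have "r * B \<le> 1 / (2 * (B + 1)) * B"
      using \<open>B \<ge> 0\<close> by (intro mult_right_mono) (auto simp: r_def)
    also have "\<dots> \<le> 1 / 2" using \<open>B \<ge> 0\<close> by (simp add: field_simps)
    finally show ?thesis .
  qed
  \<comment> \<open>The penalty then grows at rate at most \<delta> (M - 1) < 1, while the descent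
    direction found below lowers the first term at rate at least 1. With \<epsilon> = \<delta> r /
    2, the value of \<Psi> at \<open>p\<close>, a minimizer stays within r / 2 of \<open>p\<close>,
    away from the boundary of the ball.\<close>
  define \<delta> where "\<delta> = 1 / M"
  have \<delta>: "\<delta> > 0" using \<open>M \<ge> 1\<close> by (simp add: \<delta>_def)
  define \<epsilon> where "\<epsilon> = \<delta> * r / 2"
  have \<epsilon>: "\<epsilon> > 0" using \<delta> r by (simp add: \<epsilon>_def)
  define t where "t e = bar e p p + (if e = f then \<epsilon> else 0)" for e
  define \<phi> where "\<phi> q = sqrt (\<Sum>e\<in>H. (bar e q q - t e)\<^sup>2)" for q :: "'a \<Rightarrow> real ^ 'd"
  define \<Psi> where "\<Psi> q = \<phi> q + \<delta> * nrm (\<lambda>v. q v - p v)" for q :: "'a \<Rightarrow> real ^ 'd"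
  \<comment> \<open>Outside \<open>V\<close> the factor is one point, so that the product is compact
    in the whole function type and its members are extensional.\<close>
  define S where "S = (\<Pi>\<^sub>E v\<in>UNIV. if v \<in> V then cball (p v) r else {undefined})"
  have S_iff: "q \<in> S \<longleftrightarrow> (\<forall>v\<in>V. norm (q v - p v) \<le> r) \<and> (\<forall>v. v \<notin> V \<longrightarrow> q v = undefined)" for q
    unfolding S_def by (auto simp: PiE_iff dist_norm norm_minus_commute split: if_splits)
  have "compact S"
  proof -
    have "compactin (product_topology (\<lambda>_. euclidean) UNIV) S"
      unfolding S_def compactin_PiE by auto
    then show ?thesis by (simp add: euclidean_product_topology)
  qed
  moreover have "p \<in> S" using p r by (auto simp: S_iff PiE_def extensional_def)
  moreover have "continuous_on S \<Psi>"
    unfolding \<Psi>_def \<phi>_def nrm_def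
    by (intro continuous_intros continuous_on_bar continuous_on_subset[OF continuous_on_product_coordinates]) auto
  ultimately obtain q where q: "q \<in> S" "\<forall>z\<in>S. \<Psi> q \<le> \<Psi> z"
    using continuous_attains_inf[of S \<Psi>] by blast
  have "\<Psi> p = \<epsilon>"
  proof -
    have "(\<Sum>e\<in>H. (bar e p p - t e)\<^sup>2) = (\<Sum>e\<in>H. if e = f then \<epsilon>\<^sup>2 else 0)"
      by (intro sum.cong) (auto simp: t_def)
    then show ?thesis using f V(2) \<epsilon> by (simp add: \<Psi>_def \<phi>_def nrm_def)
  qed
  then have "\<Psi> q \<le> \<epsilon>" using q(2) \<open>p \<in> S\<close> by auto
  moreover have "\<phi> q \<ge> 0" by (simp add: \<phi>_def sum_nonneg)
  ultimately have "\<delta> * nrm (\<lambda>v. q v - p v) \<le> \<delta> * (r / 2)" by (simp add: \<Psi>_def \<epsilon>_def)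
  then have "nrm (\<lambda>v. q v - p v) \<le> r / 2" using \<delta> by simp
  moreover have "norm (q v - p v) \<le> nrm (\<lambda>v. q v - p v)" if "v \<in> V" for v
    unfolding nrm_def using that V(1) by (intro member_le_sum) auto
  ultimately have close: "norm (q v - p v) \<le> r / 2" if "v \<in> V" for v
    using that by fastforce
  have "\<phi> q = 0"
  proof (rule ccontr)
    assume "\<phi> q \<noteq> 0"
    then have pos: "\<phi> q > 0" using \<open>\<phi> q \<ge> 0\<close> by simp
    define u where "u e = (bar e q q - t e) / \<phi> q" for e
    have "(\<Sum>e\<in>H. (bar e q q - t e)\<^sup>2) = (\<phi> q)\<^sup>2" by (simp add: \<phi>_def sum_nonneg)
    then have u1: "(\<Sum>e\<in>H. (u e)\<^sup>2) = 1"
      using pos by (simp add: u_def power_divide sum_divide_distrib[symmetric])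
    have ule: "\<bar>u e\<bar> \<le> 1" if "e \<in> H" for e
    proof -
      have "(u e)\<^sup>2 \<le> 1" unfolding u1[symmetric] using that V(2) by (intro member_le_sum) auto
      then show ?thesis by (simp add: abs_square_le_1)
    qed
    \<comment> \<open>At \<open>p\<close> this motion would change the bars at rates exactly
      \<open>- u\<close>, the direction of steepest descent; at \<open>q\<close> the total error is
      at most \<open>r * B\<close>.\<close>
    define y where "y v = (\<Sum>g\<in>H. (- u g) *\<^sub>R x g v)" for v
    have "nrm y \<le> (\<Sum>v\<in>V. \<Sum>g\<in>H. norm (x g v))"
      unfolding nrm_def y_def
    proof (intro sum_mono order_trans[OF norm_sum])
      show "norm ((- u g) *\<^sub>R x g v) \<le> norm (x g v)" if "g \<in> H" for g v
        using ule[OF that] by (simp add: mult_left_le_one_le)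
    qed
    also have "\<dots> = M - 1" unfolding M_def nrm_def by (subst sum.swap) simp
    finally have ny: "nrm y \<le> M - 1" .
    have yV: "y v = 0" if "v \<notin> V" for v using xV that by (simp add: y_def)
    define b where "b e = bar e q y" for e
    have ub: "(\<Sum>e\<in>H. u e * b e) \<le> - (1 / 2)"
    proof -
      define er where "er e g = bar e q (x g) - bar e p (x g)" for e g
      have er: "\<bar>er e g\<bar> \<le> r * (\<Sum>u\<in>e. \<Sum>w\<in>e. 2 * norm (x g u - x g w))" if "e \<in> H" for e g
        unfolding er_def using close V(3)[OF that] r(1) by (intro bar_diff_bound) fastforce
      have "b e = - u e - (\<Sum>g\<in>H. u g * er e g)" if "e \<in> H" for e
      proof -
        have "b e = (\<Sum>g\<in>H. (- u g) * (bar e p (x g) + er e g))"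
          unfolding b_def y_def bar_sum by (simp add: er_def)
        also have "\<dots> = (\<Sum>g\<in>H. (if e = g then - u g else 0) - u g * er e g)"
          using x that by (intro sum.cong) (auto simp: algebra_simps)
        also have "\<dots> = - u e - (\<Sum>g\<in>H. u g * er e g)"
          using that V(2) by (simp add: sum_subtractf)
        finally show ?thesis .
      qed
      then have "u e * b e = - (u e)\<^sup>2 + (\<Sum>g\<in>H. - (u e * u g * er e g))" if "e \<in> H" for e
        using that by (simp add: right_diff_distrib power2_eq_square sum_negf sum_distrib_left mult.assoc)
      then have "(\<Sum>e\<in>H. u e * b e) = (\<Sum>e\<in>H. - (u e)\<^sup>2 + (\<Sum>g\<in>H. - (u e * u g * er e g)))"
        by (rule sum.cong[OF refl])
      also have "\<dots> = - 1 + (\<Sum>e\<in>H. \<Sum>g\<in>H. - (u e * u g * er e g))"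
        by (simp add: sum.distrib sum_subtractf u1 sum_negf)
      also have "(\<Sum>e\<in>H. \<Sum>g\<in>H. - (u e * u g * er e g)) \<le>
          (\<Sum>e\<in>H. \<Sum>g\<in>H. r * (\<Sum>u\<in>e. \<Sum>w\<in>e. 2 * norm (x g u - x g w)))"
      proof (intro sum_mono)
        fix e g assume eg: "e \<in> H" "g \<in> H"
        have "\<bar>u e\<bar> * \<bar>u g\<bar> \<le> 1 * 1" using ule eg by (intro mult_mono) auto
        then have "\<bar>u e\<bar> * \<bar>u g\<bar> * \<bar>er e g\<bar> \<le> 1 * \<bar>er e g\<bar>" by (intro mult_right_mono) auto
        then have "- (u e * u g * er e g) \<le> \<bar>er e g\<bar>"
          using abs_ge_minus_self[of "u e * u g * er e g"] by (simp add: abs_mult)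
        then show "- (u e * u g * er e g) \<le> r * (\<Sum>u\<in>e. \<Sum>w\<in>e. 2 * norm (x g u - x g w))"
          using er[OF eg(1), of g] by linarith
      qed
      also have "\<dots> = r * B" by (simp add: B_def sum_distrib_left)
      finally show ?thesis using rB by linarith
    qed
    define h where "h s = \<phi> (\<lambda>v. q v + s *\<^sub>R y v)" for s
    have h_eq: "h s = sqrt (\<Sum>e\<in>H. (bar e q q + 2 * s * b e + s\<^sup>2 * bar e y y - t e)\<^sup>2)" for s
      unfolding h_def \<phi>_def bar_add_scaled b_def ..
    have h0: "h 0 = \<phi> q" by (simp add: h_eq \<phi>_def)
    have sumpos: "(\<Sum>e\<in>H. (bar e q q - t e)\<^sup>2) > 0"
      using pos by (simp add: \<phi>_def)
    have "(h has_real_derivative 2 * (\<Sum>e\<in>H. u e * b e)) (at 0)"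
    proof -
      have "((\<lambda>s. \<Sum>e\<in>H. (bar e q q + 2 * s * b e + s\<^sup>2 * bar e y y - t e)\<^sup>2)
          has_real_derivative (\<Sum>e\<in>H. 2 * (bar e q q - t e) * (2 * b e))) (at 0)"
        by (auto intro!: derivative_eq_intros sum.cong)
      then have "((\<lambda>s. sqrt (\<Sum>e\<in>H. (bar e q q + 2 * s * b e + s\<^sup>2 * bar e y y - t e)\<^sup>2))
          has_real_derivative (\<Sum>e\<in>H. 2 * (bar e q q - t e) * (2 * b e)) / (2 * \<phi> q)) (at 0)"
        using sumpos by (auto intro!: derivative_eq_intros simp: \<phi>_def field_simps)
      moreover have "(\<Sum>e\<in>H. 2 * (bar e q q - t e) * (2 * b e)) / (2 * \<phi> q) = 2 * (\<Sum>e\<in>H. u e * b e)"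
        unfolding sum_divide_distrib sum_distrib_left using pos
        by (intro sum.cong) (auto simp: u_def field_simps)
      ultimately show ?thesis by (simp add: h_eq[abs_def])
    qed
    then have "((\<lambda>s. h s + \<delta> * (M - 1) * s) has_real_derivative 2 * (\<Sum>e\<in>H. u e * b e) + \<delta> * (M - 1)) (at 0)"
      by (auto intro!: derivative_eq_intros)
    moreover have "2 * (\<Sum>e\<in>H. u e * b e) + \<delta> * (M - 1) < 0"
    proof -
      have "\<delta> * (M - 1) < 1" using \<open>M \<ge> 1\<close> by (simp add: \<delta>_def)
      then show ?thesis using ub by linarith
    qed
    ultimately obtain d where d: "d > 0" "\<And>s. s > 0 \<Longrightarrow> s < d \<Longrightarrow> h (0 + s) + \<delta> * (M - 1) * (0 + s) < h 0 + \<delta> * (M - 1) * 0"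
      using DERIV_neg_dec_right by blast
    \<comment> \<open>Small enough for the strict decrease and for moving each vertex by at most r /
      2, so that \<open>z\<close> remains in the ball.\<close>
    define s where "s = min (d / 2) (r / (2 * M))"
    have s: "s > 0" "s < d" "s * M \<le> r / 2"
    proof -
      show "s > 0" "s < d" using d(1) r(1) \<open>M \<ge> 1\<close> by (auto simp: s_def)
      have "s * M \<le> r / (2 * M) * M" using \<open>M \<ge> 1\<close> by (intro mult_right_mono) (auto simp: s_def)
      then show "s * M \<le> r / 2" using \<open>M \<ge> 1\<close> by simp
    qed
    define z where "z v = q v + s *\<^sub>R y v" for v
    have "z \<in> S"
      unfolding S_iff
    proof (intro conjI ballI allI impI)
      fix v assume v: "v \<in> V"
      have "norm (y v) \<le> nrm y" unfolding nrm_def using v V(1) by (intro member_le_sum) auto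
      then have "s * norm (y v) \<le> s * M" using ny s(1) by (intro mult_left_mono) auto
      moreover have "norm (s *\<^sub>R y v) = s * norm (y v)" using s(1) by simp
      ultimately have "norm (s *\<^sub>R y v) \<le> r / 2" using s(3) by linarith
      moreover have "norm (z v - p v) \<le> norm (q v - p v) + norm (s *\<^sub>R y v)"
        using norm_triangle_ineq[of "q v - p v" "s *\<^sub>R y v"] by (simp add: z_def algebra_simps)
      ultimately show "norm (z v - p v) \<le> r" using close[OF v] by linarith
    next
      fix v assume "v \<notin> V"
      then show "z v = undefined" using q(1) yV by (simp add: S_iff z_def)
    qed
    then have "\<Psi> q \<le> \<Psi> z" using q(2) by blast
    moreover have "nrm (\<lambda>v. z v - p v) \<le> nrm (\<lambda>v. q v - p v) + s * nrm y"
      unfolding nrm_def sum_distrib_left sum.distrib[symmetric]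
    proof (rule sum_mono)
      fix v
      show "norm (z v - p v) \<le> norm (q v - p v) + s * norm (y v)"
        using norm_triangle_ineq[of "q v - p v" "s *\<^sub>R y v"] s(1) by (simp add: z_def algebra_simps)
    qed
    then have "nrm (\<lambda>v. z v - p v) \<le> nrm (\<lambda>v. q v - p v) + s * (M - 1)"
      using mult_left_mono[OF ny, of s] s(1) by linarith
    then have "\<delta> * nrm (\<lambda>v. z v - p v) \<le> \<delta> * (nrm (\<lambda>v. q v - p v) + s * (M - 1))"
      by (rule mult_left_mono) (use \<delta> in simp)
    moreover have "\<phi> z = h s" by (simp add: h_def z_def[abs_def])
    ultimately have "h 0 \<le> h s + \<delta> * (M - 1) * s"
      unfolding \<Psi>_def h0 by (simp add: algebra_simps)
    then show False using d(2)[OF s(1,2)] by simp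
  qed
  then have "(\<Sum>e\<in>H. (bar e q q - t e)\<^sup>2) = 0" by (simp add: \<phi>_def)
  then have val: "bar e q q = t e" if "e \<in> H" for e
    using that V(2) by (simp add: sum_nonneg_eq_0_iff)
  show ?thesis
  proof (intro bexI[of _ q] conjI ballI)
    show "norm (q v - p v) < \<rho>" if "v \<in> V" for v using close[OF that] r by linarith
    show "bar e q q = bar e p p" if "e \<in> H - {f}" for e using val that by (simp add: t_def)
    show "bar f q q \<noteq> bar f p p" using val[OF f] \<epsilon> by (simp add: t_def)
    show "q \<in> realizations V" using q(1) by (auto simp: S_iff PiE_def extensional_def)
  qed
qed

text \<open>If an infinitesimal motion stretches a pair \<open>f\<close>, then \<open>f\<close> is
  independent of a row basis \<open>F\<close> of \<open>E\<close>, and there are realizations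
  tending to \<open>p\<close> that keep the lengths of \<open>F\<close> but change \<open>f\<close>.
  Each remaining edge can only take finitely many lengths on this fibre, so by convergence its
  length is eventually the original one. This contradicts rigidity.\<close>

lemma rigid_fw_imp_infinitesimally_rigid:
  fixes p :: "'a \<Rightarrow> real ^ 'd::finite"
  assumes G: "simple_graph V E" and p: "p \<in> realizations V" "generic V p" and rigid: "rigid_fw V E p"
  shows "infinitesimally_rigid V E p"
proof (rule ccontr)
  assume "\<not> infinitesimally_rigid V E p"
  then obtain x u w where x: "\<forall>e\<in>E. bar e p x = 0" and uw: "u \<in> V" "w \<in> V" "bar {u, w} p x \<noteq> 0"
    unfolding infinitesimally_rigid_def by blast
  have EV: "e \<subseteq> V" if "e \<in> E" for e
    using G that by (auto simp: simple_graph_def)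
  have finV: "finite V" and finE: "finite E"
    using G by (auto simp: simple_graph_def intro: finite_subset[of E "Pow V"])
  obtain F where F: "F \<subseteq> E" "bar_independent F p"
    and max: "\<And>e x. e \<in> E \<Longrightarrow> \<forall>f\<in>F. bar f p x = 0 \<Longrightarrow> bar e p x = 0"
    using maximal_bar_independent[OF finE, of p] by blast
  have finF: "finite F" using F(1) finE finite_subset by blast
  define f where "f = {u, w}"
  have "f \<notin> F" using x uw F(1) by (auto simp: f_def)
  have "\<forall>e\<in>F. bar e p x = 0" using x F(1) by blast
  then have ind: "bar_independent (insert f F) p"
    using bar_independent_insert[OF finF F(2)] uw(3) by (simp add: f_def)
  have "\<exists>q\<in>realizations V. (\<forall>v\<in>V. norm (q v - p v) < inverse (real (Suc n))) \<and>
      (\<forall>e\<in>insert f F - {f}. bar e q q = bar e p p) \<and> bar f q q \<noteq> bar f p p" for n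
    using finV finF F(1) EV uw(1,2) ind p(1)
    by (intro bar_independent_deformation) (auto simp: f_def)
  then obtain q where q: "\<forall>n. q n \<in> realizations V \<and> (\<forall>v\<in>V. norm (q n v - p v) < inverse (real (Suc n))) \<and>
      (\<forall>e\<in>insert f F - {f}. bar e (q n) (q n) = bar e p p) \<and> bar f (q n) (q n) \<noteq> bar f p p"
    unfolding Bex_def by metis
  have lim: "(\<lambda>n. q n v) \<longlonglongrightarrow> p v" if "v \<in> V" for v
  proof (rule LIMSEQ_norm_0[THEN LIM_zero_cancel])
    show "norm (q n v - p v) < 1 / real (Suc n)" for n
      using q that by (simp add: inverse_eq_divide)
  qed
  obtain U where U: "openin (realization_topology V) U" "p \<in> U"
    "\<And>q. q \<in> U \<Longrightarrow> equivalent_fw E p q \<Longrightarrow> congruent_fw V p q"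
    using rigid unfolding rigid_fw_def by blast
  have "limitin (realization_topology V) q p sequentially"
    unfolding limitin_componentwise using lim p(1) q by (auto simp: PiE_def)
  then have evU: "eventually (\<lambda>n. q n \<in> U) sequentially"
    using U(1,2) unfolding limitin_def by blast
  have evE: "eventually (\<lambda>n. bar e (q n) (q n) = bar e p p) sequentially" if e: "e \<in> E" for e
  proof -
    obtain Z where Z: "finite Z" "\<And>q :: 'a \<Rightarrow> real ^ 'd. \<forall>f\<in>F. bar f q q = bar f p p \<Longrightarrow> bar e q q \<in> Z"
      using bar_finite_values[OF p(2) EV[OF e], of F] max[OF e] F(1) EV by blast
    have "(\<lambda>n. bar e (q n) (q n)) \<longlonglongrightarrow> bar e p p"
      unfolding bar_def using lim EV[OF e] by (intro tendsto_intros) auto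
    \<comment> \<open>Removing the finitely many other admissible values leaves a neighbourhood of
      the limit.\<close>
    moreover have "open (- (Z - {bar e p p}))" using Z(1) by (intro open_Compl finite_imp_closed) simp
    ultimately have "eventually (\<lambda>n. bar e (q n) (q n) \<in> - (Z - {bar e p p})) sequentially"
      by (rule topological_tendstoD) simp
    then show ?thesis
    proof (rule eventually_mono)
      fix n assume "bar e (q n) (q n) \<in> - (Z - {bar e p p})"
      moreover have "bar e (q n) (q n) \<in> Z" using q \<open>f \<notin> F\<close> by (intro Z(2)) auto
      ultimately show "bar e (q n) (q n) = bar e p p" by blast
    qed
  qed
  have "eventually (\<lambda>n. \<forall>e\<in>E. bar e (q n) (q n) = bar e p p) sequentially"
    using evE finE by (simp add: eventually_ball_finite)
  with evU have "eventually (\<lambda>n. q n \<in> U \<and> (\<forall>e\<in>E. bar e (q n) (q n) = bar e p p)) sequentially"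
    by (rule eventually_conj)
  then obtain n where n: "q n \<in> U" "\<forall>e\<in>E. bar e (q n) (q n) = bar e p p"
    by (auto simp: eventually_sequentially)
  have "equivalent_fw E p (q n)"
    unfolding equivalent_fw_def using n(2) by (auto simp flip: bar_pair_eq_iff)
  then have "congruent_fw V p (q n)" using U(3) n(1) by blast
  then have "bar f (q n) (q n) = bar f p p"
    using uw(1,2) by (simp add: f_def congruent_fw_def bar_pair_eq_iff)
  then show False using q by blast
qed

lemma rigid_graph_imp_infinitesimally_rigid:
  fixes p :: "'a \<Rightarrow> real ^ 'd::finite"
  assumes G: "simple_graph V E" and rigid: "rigid_graph TYPE('d) V E" and p: "generic V p"
  shows "infinitesimally_rigid V E p"
proof -
  obtain q :: "'a \<Rightarrow> real ^ 'd" where q: "q \<in> realizations V" "generic V q" "rigid_fw V E q"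
    using rigid unfolding rigid_graph_def by blast
  have "finite V" "finite E" "\<And>e. e \<in> E \<Longrightarrow> e \<subseteq> V"
    using G by (auto simp: simple_graph_def intro: finite_subset[of E "Pow V"])
  then show ?thesis
    using infinitesimally_rigid_generic[OF _ _ _ q(2) rigid_fw_imp_infinitesimally_rigid[OF G q] p] by blast
qed

section \<open>Degrees and contractions\<close>

text \<open>The Fredholm alternative by homogenization: without a solution, the extra coordinate
  \<open>snd z\<close> vanishes on the common kernel of the forms \<open>r w\<close> and lies in
  their span; the coefficients give a relation that violates \<open>rel\<close>.\<close>

lemma linear_system_solvable:
  fixes a :: "'k \<Rightarrow> real ^ 'd::finite"
  assumes N: "finite N" and rel: "\<And>c. (\<Sum>w\<in>N. c w *\<^sub>R a w) = 0 \<Longrightarrow> (\<Sum>w\<in>N. c w * b w) = 0"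
  shows "\<exists>y. \<forall>w\<in>N. a w \<bullet> y = b w"
proof (rule ccontr)
  assume no: "\<nexists>y. \<forall>w\<in>N. a w \<bullet> y = b w"
  define r where "r w z = a w \<bullet> fst z - snd z * b w" for w and z :: "(real ^ 'd) \<times> real"
  have "\<exists>c. \<forall>z. snd z = (\<Sum>w\<in>N. c w * r w z)"
  proof (rule functional_in_span[where comb = "\<lambda>x c y. x + c *\<^sub>R y"])
    fix z :: "(real ^ 'd) \<times> real" assume z: "\<forall>w\<in>N. r w z = 0"
    show "snd z = 0"
    proof (rule ccontr)
      assume "snd z \<noteq> 0"
      then have "\<forall>w\<in>N. a w \<bullet> ((1 / snd z) *\<^sub>R fst z) = b w"
        using z by (simp add: r_def)
      then show False using no by blast
    qed
  qed (use N in \<open>simp_all add: r_def inner_add_right algebra_simps\<close>)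
  then obtain c where c: "\<forall>z. snd z = (\<Sum>w\<in>N. c w * r w z)" ..
  have "(\<Sum>w\<in>N. c w *\<^sub>R a w) \<bullet> y = 0" for y
    using spec[OF c, of "(y, 0)"] by (simp add: r_def inner_sum_left)
  then have "(\<Sum>w\<in>N. c w *\<^sub>R a w) = 0" by (metis inner_eq_zero_iff)
  then have "(\<Sum>w\<in>N. c w * b w) = 0" by (rule rel)
  then show False using spec[OF c, of "(0, 1)"] by (simp add: r_def sum_negf)
qed

lemma independent_family_kernel:
  fixes a :: "'d::finite \<Rightarrow> real ^ 'd"
  assumes "\<And>c i. (\<Sum>i\<in>UNIV. c i *\<^sub>R a i) = 0 \<Longrightarrow> c i = 0" and "\<And>i. a i \<bullet> y = 0"
  shows "y = 0"
proof -
  define X :: "real ^ 'd ^ 'd" where "X = (\<chi> i. a i)"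
  have "\<exists>B. X ** B = mat 1"
    unfolding matrix_right_invertible_independent_rows
    using assms(1) by (simp add: row_def X_def scalar_mult_eq_scaleR)
  then obtain B where "B ** X = mat 1" using matrix_left_right_inverse by blast
  then have "y = B *v (X *v y)" by (simp add: matrix_vector_mul_assoc)
  also have "X *v y = 0" using assms(2) by (simp add: X_def vec_eq_iff matrix_vector_mult_def inner_vec_def)
  finally show ?thesis by simp
qed

lemma independent_family_span:
  fixes a :: "'d::finite \<Rightarrow> real ^ 'd"
  assumes "\<And>c i. (\<Sum>i\<in>UNIV. c i *\<^sub>R a i) = 0 \<Longrightarrow> c i = 0"
  shows "\<exists>\<kappa>. z = (\<Sum>i\<in>UNIV. \<kappa> i *\<^sub>R a i)"
proof -
  have "\<exists>\<kappa>. \<forall>y. z \<bullet> y = (\<Sum>i\<in>UNIV. \<kappa> i * (a i \<bullet> y))"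
  proof (rule functional_in_span[where comb = "\<lambda>x c y. x + c *\<^sub>R y"])
    fix y assume "\<forall>i\<in>UNIV. a i \<bullet> y = 0"
    then have "y = 0" using independent_family_kernel[of a y] assms by blast
    then show "z \<bullet> y = 0" by simp
  qed (simp_all add: inner_add_right)
  then obtain \<kappa> where \<kappa>: "\<forall>y. z \<bullet> y = (\<Sum>i\<in>UNIV. \<kappa> i * (a i \<bullet> y))" ..
  then have "\<forall>y. z \<bullet> y = (\<Sum>i\<in>UNIV. \<kappa> i *\<^sub>R a i) \<bullet> y" by (simp add: inner_sum_left)
  then show ?thesis using vector_eq_rdot by blast
qed

lemma generic_simplex_independent:
  fixes p :: "'a \<Rightarrow> real ^ 'd::finite" and t :: "'d \<Rightarrow> 'a"
  assumes "generic V p" "u \<in> V" "inj t" "range t \<subseteq> V - {u}"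
    and "(\<Sum>i\<in>UNIV. c i *\<^sub>R (p (t i) - p u)) = 0"
  shows "c i = 0"
proof -
  have "(\<Sum>w\<in>range t. c (inv t w) *\<^sub>R (p w - p u)) = 0"
    using assms(5) by (simp add: sum.reindex[OF assms(3)] inv_f_f[OF assms(3)])
  then have "c (inv t (t i)) = 0"
    using assms(1-4) by (intro generic_affine_independent[of V p u "range t" "\<lambda>w. c (inv t w)" "t i"])
      (auto simp: card_image)
  then show ?thesis by (simp add: inv_f_f[OF assms(3)])
qed

text \<open>The vertices other than the base point \<open>u0\<close> are indexed by the coordinate
  type, which makes the edge vectors a square system. The vertex \<open>u1\<close> is kept because
  the length of the edge from \<open>u0\<close> to \<open>u1\<close> is to be compared.\<close>

lemma obtain_simplex:
  assumes "CARD('d::finite) < card N" "u0 \<in> N" "u1 \<in> N" "u0 \<noteq> u1"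
  obtains t :: "'d::finite \<Rightarrow> 'a" where "inj t" "range t \<subseteq> N - {u0}" "u1 \<in> range t"
proof -
  have fin: "finite N" using assms(1) card.infinite by fastforce
  have "CARD('d) - 1 \<le> card (N - {u0, u1})"
    using assms fin by (simp add: card_Diff_subset)
  then obtain T where T: "T \<subseteq> N - {u0, u1}" "card T = CARD('d) - 1" "finite T"
    by (rule obtain_subset_with_card_n)
  have "u1 \<notin> T" using T(1) by blast
  then have "card (insert u1 T) = CARD('d)" using T by simp
  then obtain t :: "'d \<Rightarrow> 'a" where "bij_betw t UNIV (insert u1 T)"
    using finite_same_card_bij[of "UNIV :: 'd set" "insert u1 T"] T(3) by auto
  then have "inj t" "range t = insert u1 T" by (auto simp: bij_betw_def)
  then show thesis using that[of t] T(1) assms by auto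
qed

section \<open>Neighbourhoods and removal of a vertex\<close>

definition neighbours :: "'a set set \<Rightarrow> 'a \<Rightarrow> 'a set" where
  "neighbours E v = {w. {v, w} \<in> E}"

definition clique :: "'a set \<Rightarrow> 'a set set" where
  "clique N = {{a, b} |a b. a \<in> N \<and> b \<in> N \<and> a \<noteq> b}"

lemma simple_graphD:
  assumes "simple_graph V E"
  shows "finite V" "finite E" "\<And>e. e \<in> E \<Longrightarrow> e \<subseteq> V"
  using assms by (auto simp: simple_graph_def intro: finite_subset[of E "Pow V"])

lemma neighbours_subset:
  assumes "simple_graph V E"
  shows "neighbours E v \<subseteq> V - {v}"
proof
  fix w assume "w \<in> neighbours E v"
  then have "{v, w} \<subseteq> V \<and> card {v, w} = 2"
    using assms unfolding neighbours_def simple_graph_def by blast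
  then show "w \<in> V - {v}" by (cases "v = w") auto
qed

lemma finite_neighbours: "simple_graph V E \<Longrightarrow> finite (neighbours E v)"
  using neighbours_subset[of V E v] by (auto simp: simple_graph_def intro: finite_subset)

lemma simple_graph_edge_at:
  assumes "simple_graph V E" "e \<in> E" "v \<in> e"
  obtains w where "w \<in> neighbours E v" "e = {v, w}"
proof -
  have "card e = 2" using assms by (simp add: simple_graph_def)
  then obtain a b where "e = {a, b}" by (auto simp: card_2_iff)
  then have "e = {v, a} \<or> e = {v, b}" using assms(3) by auto
  then show thesis using that assms(2) by (auto simp: neighbours_def)
qed

lemma simple_graph_del: "simple_graph V E \<Longrightarrow> simple_graph (V - {v}) (del_edges E v)"
  by (auto simp: simple_graph_def del_edges_def)

lemma neighbours_del: "w \<noteq> v \<Longrightarrow> neighbours (del_edges E w) v = neighbours E v - {w}"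
  by (auto simp: neighbours_def del_edges_def)

text \<open>With fewer than d neighbours, the vectors from \<open>u\<close> to its neighbours and to
  \<open>w\<close> are independent. So \<open>u\<close> can be given a velocity orthogonal to all
  its edges but not to the missing edge to \<open>w\<close>.\<close>

lemma infinitesimally_rigid_degree:
  fixes p :: "'a \<Rightarrow> real ^ 'd::finite"
  assumes G: "simple_graph V E" and p: "generic V p" "infinitesimally_rigid V E p"
    and uw: "u \<in> V" "w \<in> V" "u \<noteq> w" "{u, w} \<notin> E"
  shows "CARD('d) \<le> card (neighbours E u)"
proof (rule ccontr)
  assume "\<not> CARD('d) \<le> card (neighbours E u)"
  define N where "N = insert w (neighbours E u)"
  have N: "finite N" "N \<subseteq> V - {u}" "card N \<le> CARD('d)"
    using finite_neighbours[OF G, of u] neighbours_subset[OF G, of u] uw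
      \<open>\<not> CARD('d) \<le> card (neighbours E u)\<close>
    by (auto simp: N_def card_insert_if)
  define b where "b z = (if z = w then 1 else 0 :: real)" for z
  have "\<exists>y. \<forall>z\<in>N. (p z - p u) \<bullet> y = b z"
  proof (rule linear_system_solvable[OF N(1)])
    fix c assume "(\<Sum>z\<in>N. c z *\<^sub>R (p z - p u)) = 0"
    then have "c z = 0" if "z \<in> N" for z
      using generic_affine_independent[OF p(1) uw(1) N(2,1,3)] that by blast
    then show "(\<Sum>z\<in>N. c z * b z) = 0" by simp
  qed
  then obtain y where y: "\<forall>z\<in>N. (p z - p u) \<bullet> y = b z" ..
  define x where "x v = (if v = u then y else 0)" for v
  have "bar e p x = 0" if e: "e \<in> E" for e
  proof (cases "u \<in> e")
    case True
    then obtain z where z: "z \<in> neighbours E u" "e = {u, z}" using simple_graph_edge_at[OF G e] by blast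
    then have "z \<noteq> u" "z \<noteq> w" "z \<in> N" using N(2) uw(4) by (auto simp: N_def neighbours_def)
    then have "(p z - p u) \<bullet> y = 0" using y by (simp add: b_def)
    then have "(p u - p z) \<bullet> y = 0" by (simp add: inner_diff_left)
    then show ?thesis using \<open>z \<noteq> u\<close> z(2) by (simp add: bar_pair x_def)
  next
    case False
    then have "bar e p x = bar e p (\<lambda>v. 0)" by (intro bar_cong) (auto simp: x_def)
    then show ?thesis by simp
  qed
  then have "bar {w, u} p x = 0" using p(2) uw unfolding infinitesimally_rigid_def by blast
  moreover have "(p w - p u) \<bullet> y = 1" using y by (simp add: N_def b_def)
  ultimately show False using uw(3) by (simp add: bar_pair x_def)
qed

text \<open>Sum the assumption with weights \<open>l a * l b\<close>. The mixed terms contain the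
  vanishing sum of the \<open>l w *\<^sub>R c w\<close>, and what remains is twice the claimed sum
  times the total weight.\<close>

lemma clique_motion_relation_nonzero:
  fixes c x :: "'a \<Rightarrow> 'b::real_inner"
  assumes "\<And>a b. a \<in> N \<Longrightarrow> b \<in> N \<Longrightarrow> (c a - c b) \<bullet> (x a - x b) = 0"
    and "(\<Sum>w\<in>N. l w *\<^sub>R c w) = 0" "(\<Sum>w\<in>N. l w) \<noteq> 0"
  shows "(\<Sum>w\<in>N. l w * (c w \<bullet> x w)) = 0"
proof -
  have inner_sum: "(\<Sum>a\<in>N. f a) \<bullet> (\<Sum>b\<in>N. g b) = (\<Sum>a\<in>N. \<Sum>b\<in>N. f a \<bullet> g b)" for f g :: "'a \<Rightarrow> 'b"
    by (subst inner_sum_left, subst inner_sum_right) (rule refl)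
  let ?L = "\<Sum>w\<in>N. l w" and ?T = "\<Sum>w\<in>N. l w * (c w \<bullet> x w)"
  have "0 = (\<Sum>a\<in>N. \<Sum>b\<in>N. l a * l b * ((c a - c b) \<bullet> (x a - x b)))"
    using assms(1) by simp
  also have "\<dots> = (\<Sum>a\<in>N. \<Sum>b\<in>N. (l a * (c a \<bullet> x a)) * l b + l a * (l b * (c b \<bullet> x b))
      - (l a *\<^sub>R c a) \<bullet> (l b *\<^sub>R x b) - (l a *\<^sub>R x a) \<bullet> (l b *\<^sub>R c b))"
    by (intro sum.cong) (auto simp: inner_diff_left inner_diff_right inner_commute algebra_simps)
  also have "\<dots> = ?T * ?L + ?L * ?T - (\<Sum>w\<in>N. l w *\<^sub>R c w) \<bullet> (\<Sum>w\<in>N. l w *\<^sub>R x w)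
      - (\<Sum>w\<in>N. l w *\<^sub>R x w) \<bullet> (\<Sum>w\<in>N. l w *\<^sub>R c w)"
    by (simp only: sum_product inner_sum sum_subtractf sum.distrib)
  finally show ?thesis using assms(2,3) by simp
qed

text \<open>The points of \<open>N\<close> affinely span the space, so \<open>z\<close> is an affine
  combination of them; the weight of the base point \<open>u0\<close> is adjusted to make the total
  1.\<close>

lemma generic_affine_hull:
  fixes p :: "'a \<Rightarrow> real ^ 'd::finite"
  assumes p: "generic W p" and N: "N \<subseteq> W" "finite N" "CARD('d) < card N"
  shows "\<exists>m. (\<Sum>w\<in>N. m w *\<^sub>R (p w - z)) = 0 \<and> (\<Sum>w\<in>N. m w) \<noteq> 0"
proof -
  have "card N \<ge> 2" using N(3) zero_less_card_finite[where ?'a = 'd] by linarith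
  then obtain u0 u1 where u: "u0 \<in> N" "u1 \<in> N" "u0 \<noteq> u1"
    by (metis card_le_Suc0_iff_eq N(2) not_less_eq_eq numeral_2_eq_2)
  obtain t :: "'d \<Rightarrow> 'a" where t: "inj t" "range t \<subseteq> N - {u0}"
    using obtain_simplex[OF N(3) u] by blast
  have "\<exists>\<kappa>. z - p u0 = (\<Sum>i\<in>UNIV. \<kappa> i *\<^sub>R (p (t i) - p u0))"
    using N(1) u t by (intro independent_family_span generic_simplex_independent[OF p _ t(1)]) auto
  then obtain \<kappa> where \<kappa>: "z - p u0 = (\<Sum>i\<in>UNIV. \<kappa> i *\<^sub>R (p (t i) - p u0))" ..
  define n where "n w = (if w \<in> range t then \<kappa> (inv t w) else 0)" for w
  define m where "m w = (if w = u0 then 1 - (\<Sum>i\<in>UNIV. \<kappa> i) else n w)" for w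
  have n: "(\<Sum>w\<in>N - {u0}. n w *\<^sub>R f w) = (\<Sum>i\<in>UNIV. \<kappa> i *\<^sub>R f (t i))" for f :: "'a \<Rightarrow> 'b::real_vector"
  proof -
    have "(\<Sum>w\<in>N - {u0}. n w *\<^sub>R f w) = (\<Sum>w\<in>range t. n w *\<^sub>R f w)"
      by (rule sum.mono_neutral_right) (use t N(2) in \<open>auto simp: n_def\<close>)
    also have "\<dots> = (\<Sum>i\<in>UNIV. \<kappa> i *\<^sub>R f (t i))"
      by (simp add: sum.reindex[OF t(1)] n_def inv_f_f[OF t(1)])
    finally show ?thesis .
  qed
  have m: "(\<Sum>w\<in>N. m w *\<^sub>R f w) = (1 - (\<Sum>i\<in>UNIV. \<kappa> i)) *\<^sub>R f u0 + (\<Sum>i\<in>UNIV. \<kappa> i *\<^sub>R f (t i))"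
    for f :: "'a \<Rightarrow> 'b::real_vector"
  proof -
    have "(\<Sum>w\<in>N - {u0}. m w *\<^sub>R f w) = (\<Sum>w\<in>N - {u0}. n w *\<^sub>R f w)"
      by (intro sum.cong) (auto simp: m_def)
    then show ?thesis using n by (simp add: sum.remove[OF N(2) u(1)] m_def)
  qed
  have "(\<Sum>w\<in>N. m w) = 1" using m[of "\<lambda>_. 1 :: real"] by simp
  moreover have "(\<Sum>w\<in>N. m w *\<^sub>R (p w - z)) = 0"
  proof -
    have "(\<Sum>w\<in>N. m w *\<^sub>R (p w - z)) = (p u0 - z) + (\<Sum>i\<in>UNIV. \<kappa> i *\<^sub>R (p (t i) - p u0))"
      unfolding m by (simp add: algebra_simps sum.distrib sum_subtractf scaleR_left.sum)
    then show ?thesis by (simp flip: \<kappa>)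
  qed
  ultimately show ?thesis by auto
qed

text \<open>The compatibility condition for extending a motion of the clique on \<open>N\<close> to
  the vertex \<open>v\<close>. A relation of total weight 0 is handled by adding one of nonzero
  weight and subtracting the two results.\<close>

lemma clique_motion_relation:
  fixes p :: "'a \<Rightarrow> real ^ 'd::finite"
  assumes p: "generic W p" and N: "v \<in> W" "N \<subseteq> W - {v}" "finite N"
    and x: "\<And>a b. a \<in> N \<Longrightarrow> b \<in> N \<Longrightarrow> (p a - p b) \<bullet> (x a - x b) = 0"
    and l: "(\<Sum>w\<in>N. l w *\<^sub>R (p w - p v)) = 0"
  shows "(\<Sum>w\<in>N. l w * ((p w - p v) \<bullet> x w)) = 0"
proof (cases "card N \<le> CARD('d)")
  case True
  then have "l w = 0" if "w \<in> N" for w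
    using generic_affine_independent[OF p N _ l that] by blast
  then show ?thesis by simp
next
  case False
  have nonzero: "(\<Sum>w\<in>N. k w * ((p w - p v) \<bullet> x w)) = 0"
    if "(\<Sum>w\<in>N. k w *\<^sub>R (p w - p v)) = 0" "(\<Sum>w\<in>N. k w) \<noteq> 0" for k
    using x that by (intro clique_motion_relation_nonzero) auto
  show ?thesis
  proof (cases "(\<Sum>w\<in>N. l w) = 0")
    case True
    have "\<exists>m. (\<Sum>w\<in>N. m w *\<^sub>R (p w - p v)) = 0 \<and> (\<Sum>w\<in>N. m w) \<noteq> 0"
      using N False by (intro generic_affine_hull[OF p]) auto
    then obtain m where m: "(\<Sum>w\<in>N. m w *\<^sub>R (p w - p v)) = 0" "(\<Sum>w\<in>N. m w) \<noteq> 0" by blast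
    have "(\<Sum>w\<in>N. (m w + l w) * ((p w - p v) \<bullet> x w)) = 0"
      using m l True by (intro nonzero) (auto simp: scaleR_left_distrib sum.distrib)
    then show ?thesis using nonzero[OF m] by (simp add: distrib_right sum.distrib)
  qed (rule nonzero[OF l])
qed

text \<open>A motion that stretches no bar of the clique extends to \<open>v\<close> without
  stretching the edges at \<open>v\<close>; then rigidity of the larger graph applies.\<close>

lemma infinitesimally_rigid_contract:
  fixes p :: "'a \<Rightarrow> real ^ 'd::finite"
  assumes G: "simple_graph W E" and p: "generic W p" "infinitesimally_rigid W E p" and v: "v \<in> W"
  shows "infinitesimally_rigid (W - {v}) (del_edges E v \<union> clique (neighbours E v)) p"
  unfolding infinitesimally_rigid_def
proof (intro allI impI ballI)
  let ?N = "neighbours E v"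
  fix x u w assume x: "\<forall>e\<in>del_edges E v \<union> clique ?N. bar e p x = 0" and uw: "u \<in> W - {v}" "w \<in> W - {v}"
  have N: "finite ?N" "?N \<subseteq> W - {v}" using finite_neighbours[OF G] neighbours_subset[OF G] by auto
  have "\<exists>y. \<forall>w\<in>?N. (p w - p v) \<bullet> y = (p w - p v) \<bullet> x w"
  proof (rule linear_system_solvable[OF N(1)])
    fix c assume c: "(\<Sum>w\<in>?N. c w *\<^sub>R (p w - p v)) = 0"
    have "(p a - p b) \<bullet> (x a - x b) = 0" if "a \<in> ?N" "b \<in> ?N" for a b
    proof (cases "a = b")
      case False
      then have "{a, b} \<in> clique ?N" using that by (auto simp: clique_def)
      then have "bar {a, b} p x = 0" using x by blast
      then show ?thesis by (simp add: bar_pair)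
    qed simp
    from clique_motion_relation[OF p(1) v N(2,1) this c]
    show "(\<Sum>w\<in>?N. c w * ((p w - p v) \<bullet> x w)) = 0" .
  qed
  then obtain y where y: "\<forall>w\<in>?N. (p w - p v) \<bullet> y = (p w - p v) \<bullet> x w" ..
  define x' where "x' = x(v := y)"
  have "bar e p x' = 0" if e: "e \<in> E" for e
  proof (cases "v \<in> e")
    case True
    then obtain w where w: "w \<in> ?N" "e = {v, w}" using simple_graph_edge_at[OF G e] by blast
    then have "w \<noteq> v" using N(2) by blast
    have "(p v - p w) \<bullet> (y - x w) = 0"
      using y w(1) by (simp add: inner_diff_left inner_diff_right algebra_simps)
    then show ?thesis using w(2) \<open>w \<noteq> v\<close> by (simp add: bar_pair x'_def)
  next
    case False
    then have "e \<in> del_edges E v" using e by (simp add: del_edges_def)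
    then have "bar e p x = 0" using x by blast
    moreover have "bar e p x' = bar e p x" using False by (intro bar_cong) (auto simp: x'_def)
    ultimately show ?thesis by simp
  qed
  then have "bar {u, w} p x' = 0" using p(2) uw unfolding infinitesimally_rigid_def by blast
  moreover have "bar {u, w} p x' = bar {u, w} p x" using uw by (intro bar_cong) (auto simp: x'_def)
  ultimately show "bar {u, w} p x = 0" by simp
qed

section \<open>Global rigidity\<close>

lemma inner_polarization: "2 * (a \<bullet> b) = a \<bullet> a + b \<bullet> b - (a - b) \<bullet> (a - b)"
  by (simp add: inner_diff_left inner_diff_right inner_commute)

text \<open>The derivations used here vanish on \<open>p\<close> restricted to \<open>V - {v}\<close>, and hence on all mutual
  distances of the points \<open>q w\<close> with \<open>w \<noteq> v\<close>, because \<open>G - v\<close> is infinitesimally rigid at \<open>q\<close>;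
  on \<open>p v\<close> they take an arbitrary value \<open>a\<close>.\<close>

lemma neighbours_congruent:
  fixes p q :: "'a \<Rightarrow> real ^ 'd::finite"
  assumes G: "simple_graph V E" and p: "generic V p" and v: "v \<in> V"
    and rigid: "infinitesimally_rigid (V - {v}) (del_edges E v) p"
    and eq: "\<And>e. e \<in> E \<Longrightarrow> bar e p p = bar e q q"
    and deg: "CARD('d) < card (neighbours E v)"
    and u: "u0 \<in> neighbours E v" "u1 \<in> neighbours E v"
  shows "norm (p u0 - p u1) = norm (q u0 - q u1)"
proof (cases "u0 = u1")
  case False
  let ?N = "neighbours E v" and ?W = "V - {v}"
  have NW: "?N \<subseteq> ?W" by (rule neighbours_subset[OF G])
  obtain t :: "'d \<Rightarrow> 'a" where t: "inj t" "range t \<subseteq> ?N - {u0}" "u1 \<in> range t"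
    using obtain_simplex[OF deg u False] by blast
  then obtain j1 where j1: "u1 = t j1" by blast
  have tN: "t i \<in> ?N" "t i \<noteq> u0" for i using t(2) by auto
  define x where "x i = p (t i) - p u0" for i
  define y where "y i = q (t i) - q u0" for i
  define ph where "ph = p v - p u0"
  define z where "z = q v - q u0"
  have x_ind: "c i = 0" if "(\<Sum>i\<in>UNIV. c i *\<^sub>R x i) = 0" for c i
    using that NW u(1) t(1,2) unfolding x_def
    by (intro generic_simplex_independent[OF p _ t(1)]) auto
  have len: "(p v - p w) \<bullet> (p v - p w) = (q v - q w) \<bullet> (q v - q w)" if "w \<in> ?N" for w
    using eq[of "{v, w}"] that by (simp add: neighbours_def bar_pair)
  have yz: "2 * (y i \<bullet> z) = 2 * (x i \<bullet> ph) + y i \<bullet> y i - x i \<bullet> x i" for i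
  proof -
    have "z \<bullet> z = ph \<bullet> ph" using len[OF u(1)] by (simp add: z_def ph_def)
    moreover have "(z - y i) \<bullet> (z - y i) = (ph - x i) \<bullet> (ph - x i)"
      using len[OF tN(1)] by (simp add: z_def ph_def x_def y_def)
    ultimately show ?thesis
      using inner_polarization[of z "y i"] inner_polarization[of ph "x i"] by (simp add: inner_commute)
  qed
  have rigid_q: "infinitesimally_rigid ?W (del_edges E v) q"
  proof (rule infinitesimally_rigid_equivalent[OF _ _ _ _ rigid])
    show "e \<subseteq> ?W" if "e \<in> del_edges E v" for e
      using simple_graphD(3)[OF simple_graph_del[OF G] that] .
    show "finite ?W" "finite (del_edges E v)" using simple_graphD[OF simple_graph_del[OF G]] by blast+
    show "generic ?W p" using generic_subset[OF p] by blast
    show "bar e p p = bar e q q" if "e \<in> del_edges E v" for e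
      using eq that by (simp add: del_edges_def)
  qed
  define der where "der D a \<longleftrightarrow> derivation D \<and> vec_map D ph = a \<and> (\<forall>i. vec_map D (x i) = 0) \<and>
      (\<forall>i j. D (y i \<bullet> y j) = 0)" for D a
  have der: "\<exists>D. der D a" for a
  proof -
    obtain D where D: "derivation D" "\<forall>w\<in>V. \<forall>i. D (p w $ i) = (if w = v then a else 0) $ i"
      using generic_derivation[OF p, of "\<lambda>w. if w = v then a else 0"] by blast
    have pw: "vec_map D (p w) = (if w = v then a else 0)" if "w \<in> V" for w
      using D(2) that by (simp add: vec_map_def vec_eq_iff)
    have "bar e q (\<lambda>w. vec_map D (q w)) = 0" if e: "e \<in> del_edges E v" for e
    proof -
      have "e \<subseteq> ?W" "e \<in> E" using simple_graphD(3)[OF simple_graph_del[OF G] e] e by (auto simp: del_edges_def)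
      then have "bar e p (\<lambda>w. vec_map D (p w)) = bar e p (\<lambda>w. 0)"
      proof (intro bar_cong refl)
        fix w assume "w \<in> e"
        then have "w \<in> V" "w \<noteq> v" using \<open>e \<subseteq> ?W\<close> by auto
        then show "vec_map D (p w) = 0" using pw by simp
      qed
      then have "D (bar e p p) = 0" by (simp add: derivation_bar[OF D(1)])
      then show ?thesis using eq[OF \<open>e \<in> E\<close>] by (simp add: derivation_bar[OF D(1)])
    qed
    then have motion: "bar {u, w} q (\<lambda>w. vec_map D (q w)) = 0" if "u \<in> ?W" "w \<in> ?W" for u w
      using rigid_q that unfolding infinitesimally_rigid_def by blast
    have dist0: "D ((q u - q w) \<bullet> (q u - q w)) = 0" if "u \<in> ?W" "w \<in> ?W" for u w
      using derivation_bar[OF D(1), of "{u, w}" q] motion[OF that]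
      by (simp add: bar_pair derivation_double[OF D(1)])
    have W: "u0 \<in> ?W" "t i \<in> ?W" for i using NW u(1) tN(1) by auto
    have "D (y i \<bullet> y j) = 0" for i j
    proof -
      have "D (2 * (y i \<bullet> y j)) = D (y i \<bullet> y i) + D (y j \<bullet> y j) - D ((y i - y j) \<bullet> (y i - y j))"
        unfolding inner_polarization[of "y i" "y j"] by (simp add: derivation_add[OF D(1)] derivation_diff[OF D(1)])
      also have "\<dots> = 0" using dist0[OF W(2) W(1)] dist0[OF W(2) W(2)] by (simp add: y_def)
      finally show ?thesis by (simp add: derivation_double[OF D(1)])
    qed
    moreover have "vec_map D ph = a" "vec_map D (x i) = 0" for i
      using pw[OF v] pw[of u0] pw[of "t i"] W by (auto simp: ph_def x_def vec_map_diff[OF D(1)])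
    ultimately show ?thesis using D(1) unfolding der_def by blast
  qed
  have Dxph: "D (x i \<bullet> ph) = x i \<bullet> a" and Dph: "D (ph \<bullet> ph) = 2 * (ph \<bullet> a)"
    and Dxx: "D (x i \<bullet> x j) = 0" and Dyy: "D (y i \<bullet> y j) = 0" and D: "derivation D" if "der D a" for D a i j
    using that by (auto simp: der_def derivation_inner inner_commute)
  have Dyz: "D (y i \<bullet> z) = x i \<bullet> a" if d: "der D a" for D a i
  proof -
    have "D (2 * (y i \<bullet> z)) = 2 * (x i \<bullet> a)"
      unfolding yz by (simp add: derivation_add derivation_diff derivation_double D[OF d] Dxph[OF d] Dyy[OF d] Dxx[OF d])
    then show ?thesis by (simp add: derivation_double[OF D[OF d]])
  qed
  have y_ind: "c i = 0" if c: "(\<Sum>j\<in>UNIV. c j *\<^sub>R y j) = 0" for c i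
  proof (rule x_ind)
    \<comment> \<open>The velocity of \<open>p v\<close> is chosen to be the very vector that has to
      vanish. Differentiating the relation paired with \<open>y i\<close> gives
      \<open>r = 0\<close>; paired with \<open>z\<close>, it gives
      \<open>a \<bullet> a + r \<bullet> z = 0\<close>.\<close>
    define a where "a = (\<Sum>j\<in>UNIV. c j *\<^sub>R x j)"
    obtain D where d: "der D a" using der by blast
    define r where "r = (\<Sum>j\<in>UNIV. D (c j) *\<^sub>R y j)"
    have ry: "r \<bullet> y i = 0" for i
    proof -
      have "(\<Sum>j\<in>UNIV. c j * (y j \<bullet> y i)) = 0" using c by (simp flip: inner_scaleR_left inner_sum_left)
      then have "D (\<Sum>j\<in>UNIV. c j * (y j \<bullet> y i)) = 0" by (simp add: derivation_0[OF D[OF d]])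
      then show ?thesis
        by (simp add: derivation_sum[OF D[OF d]] derivation_mult[OF D[OF d]] Dyy[OF d] r_def inner_sum_left)
    qed
    then have "(\<Sum>j\<in>UNIV. D (c j) * (r \<bullet> y j)) = 0" by simp
    then have "r \<bullet> r = 0" by (subst (2) r_def) (simp add: inner_sum_right)
    then have "r = 0" by simp
    have "(\<Sum>j\<in>UNIV. c j * (y j \<bullet> z)) = 0" using c by (simp flip: inner_scaleR_left inner_sum_left)
    then have "D (\<Sum>j\<in>UNIV. c j * (y j \<bullet> z)) = 0" by (simp add: derivation_0[OF D[OF d]])
    then have "a \<bullet> a + r \<bullet> z = 0"
      by (simp add: derivation_sum[OF D[OF d]] derivation_mult[OF D[OF d]] Dyz[OF d] sum.distrib
          r_def inner_sum_left) (simp add: a_def inner_sum_left)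
    then show "(\<Sum>j\<in>UNIV. c j *\<^sub>R x j) = 0" using \<open>r = 0\<close> by (simp add: a_def)
  qed
  obtain s where s: "z = (\<Sum>j\<in>UNIV. s j *\<^sub>R y j)"
    using independent_family_span[of y z] y_ind by blast
  have Dz: "y i \<bullet> (\<Sum>j\<in>UNIV. D (s j) *\<^sub>R y j) = x i \<bullet> a" if d: "der D a" for D a i
  proof -
    have "D (\<Sum>j\<in>UNIV. s j * (y i \<bullet> y j)) = x i \<bullet> a"
      using Dyz[OF d, of i] by (simp add: s inner_sum_right)
    then show ?thesis
      by (simp add: derivation_sum[OF D[OF d]] derivation_mult[OF D[OF d]] Dyy[OF d] inner_sum_right)
  qed
  \<comment> \<open>Differentiate the equality of \<open>z \<bullet> z\<close> and
    \<open>ph \<bullet> ph\<close>, with \<open>z\<close> expanded in the basis \<open>y\<close>. By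
    \<open>Dz\<close> the two terms of the product rule coincide, so each is
    \<open>ph \<bullet> a\<close>, for every \<open>a\<close>.\<close>
  have ph: "ph = (\<Sum>j\<in>UNIV. s j *\<^sub>R x j)"
  proof -
    have "(\<Sum>j\<in>UNIV. s j *\<^sub>R x j) \<bullet> a = ph \<bullet> a" for a
    proof -
      obtain D where d: "der D a" using der by blast
      let ?r = "\<Sum>j\<in>UNIV. D (s j) *\<^sub>R y j"
      have sx: "(\<Sum>j\<in>UNIV. s j * (x j \<bullet> a)) = z \<bullet> ?r"
        unfolding Dz[OF d, symmetric] by (simp add: s inner_sum_left)
      have "(\<Sum>j\<in>UNIV. s j * (y j \<bullet> z)) = ph \<bullet> ph"
        using len[OF u(1)] by (subst s[symmetric] inner_scaleR_left[symmetric] inner_sum_left[symmetric])+ (simp add: z_def ph_def)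
      then have "D (\<Sum>j\<in>UNIV. s j * (y j \<bullet> z)) = 2 * (ph \<bullet> a)" by (simp add: Dph[OF d])
      then have "(\<Sum>j\<in>UNIV. s j * (x j \<bullet> a)) + ?r \<bullet> z = 2 * (ph \<bullet> a)"
        by (simp add: derivation_sum[OF D[OF d]] derivation_mult[OF D[OF d]] Dyz[OF d] sum.distrib inner_sum_left)
      then show ?thesis using sx by (simp add: inner_commute[of z] inner_sum_left)
    qed
    then show ?thesis using vector_eq_rdot by metis
  qed
  \<comment> \<open>With this velocity \<open>a\<close> of \<open>p v\<close>, the equations
    \<open>Dz\<close> force \<open>D\<close> to move the coefficient of \<open>y j1\<close> at rate
    1 and to annihilate the others.\<close>
  have "\<exists>a. \<forall>i\<in>UNIV. x i \<bullet> a = y i \<bullet> y j1"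
  proof (rule linear_system_solvable)
    fix c assume "(\<Sum>i\<in>UNIV. c i *\<^sub>R x i) = 0"
    then have "c i = 0" for i by (rule x_ind)
    then show "(\<Sum>i\<in>UNIV. c i * (y i \<bullet> y j1)) = 0" by simp
  qed simp
  then obtain a where a: "\<forall>i\<in>UNIV. x i \<bullet> a = y i \<bullet> y j1" ..
  obtain D where d: "der D a" using der by blast
  let ?r = "\<Sum>j\<in>UNIV. D (s j) *\<^sub>R y j"
  have "?r - y j1 = 0"
  proof (rule independent_family_kernel[of y])
    show "y i \<bullet> (?r - y j1) = 0" for i using Dz[OF d, of i] a by (simp add: inner_diff_right)
  qed (rule y_ind)
  then have "(\<Sum>j\<in>UNIV. (D (s j) - (if j = j1 then 1 else 0)) *\<^sub>R y j) = 0"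
    by (simp add: scaleR_left_diff_distrib sum_subtractf if_distrib[of "\<lambda>c. c *\<^sub>R _"] cong: if_cong)
  from y_ind[OF this] have Ds: "D (s j) = (if j = j1 then 1 else 0)" for j by (metis eq_iff_diff_eq_0)
  \<comment> \<open>The length equation in terms of \<open>s\<close> and Gram entries.
    \<open>D\<close> annihilates the Gram entries, so only the terms with
    \<open>D (s j1) = 1\<close> survive.\<close>
  have "2 * (\<Sum>j\<in>UNIV. s j * (y j1 \<bullet> y j)) = 2 * (\<Sum>j\<in>UNIV. s j * (x j1 \<bullet> x j)) + y j1 \<bullet> y j1 - x j1 \<bullet> x j1"
    using yz[of j1] by (simp add: s ph inner_sum_right)
  then have "D (2 * (\<Sum>j\<in>UNIV. s j * (y j1 \<bullet> y j))) =
      D (2 * (\<Sum>j\<in>UNIV. s j * (x j1 \<bullet> x j)) + y j1 \<bullet> y j1 - x j1 \<bullet> x j1)" by simp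
  then have "y j1 \<bullet> y j1 = x j1 \<bullet> x j1"
    by (simp add: derivation_add derivation_diff derivation_double derivation_sum derivation_mult D[OF d]
        Dyy[OF d] Dxx[OF d] Ds if_distrib[of "\<lambda>c. c * _"] cong: if_cong)
  then have "norm (x j1) = norm (y j1)" by (simp add: norm_eq_sqrt_inner)
  then show ?thesis by (simp add: x_def y_def j1 norm_minus_commute)
qed simp

text \<open>Express \<open>X w\<close> in the simplex edges. As all dot products away from
  \<open>v\<close> agree for \<open>p\<close> and \<open>q\<close>, \<open>Y w\<close> is the
  combination \<open>K\<close> with the same coefficients; its product with \<open>Y v\<close> is
  then determined by the products at the simplex, which agree by \<open>len\<close>.\<close>

lemma congruent_extend:
  fixes p q :: "'a \<Rightarrow> real ^ 'd::finite"
  assumes p: "generic V p" and N: "N \<subseteq> V - {v}" "CARD('d) < card N"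
    and len: "\<And>w. w \<in> N \<Longrightarrow> norm (p v - p w) = norm (q v - q w)"
    and cong: "congruent_fw (V - {v}) p q"
  shows "congruent_fw V p q"
proof -
  have "card N \<ge> 2" using N(2) zero_less_card_finite[where ?'a = 'd] by linarith
  moreover have "finite N" using N(2) card.infinite by fastforce
  ultimately obtain u0 u1 where u: "u0 \<in> N" "u1 \<in> N" "u0 \<noteq> u1"
    by (metis card_le_Suc0_iff_eq not_less_eq_eq numeral_2_eq_2)
  obtain t :: "'d \<Rightarrow> 'a" where t: "inj t" "range t \<subseteq> N - {u0}"
    using obtain_simplex[OF N(2) u] by blast
  define X where "X w = p w - p u0" for w
  define Y where "Y w = q w - q u0" for w
  have sq: "norm x = norm y \<longleftrightarrow> x \<bullet> x = y \<bullet> y" for x y :: "real ^ 'd"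
    by (simp add: norm_eq_sqrt_inner)
  have dist: "(X a - X b) \<bullet> (X a - X b) = (Y a - Y b) \<bullet> (Y a - Y b)" if "a \<in> V - {v}" "b \<in> V - {v}" for a b
    using cong that unfolding congruent_fw_def by (simp add: X_def Y_def sq)
  have self: "X a \<bullet> X a = Y a \<bullet> Y a" if "a \<in> V - {v}" for a
    using dist[OF that, of u0] u(1) N(1) by (auto simp: X_def Y_def)
  have gram: "X a \<bullet> X b = Y a \<bullet> Y b" if "a \<in> V - {v}" "b \<in> V - {v}" for a b
    using inner_polarization[of "X a" "X b"] inner_polarization[of "Y a" "Y b"] dist[OF that] self that by simp
  have lenv: "(X v - X w) \<bullet> (X v - X w) = (Y v - Y w) \<bullet> (Y v - Y w)" if "w \<in> N" for w
    using len[OF that] by (simp add: X_def Y_def sq)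
  have selfv: "X v \<bullet> X v = Y v \<bullet> Y v" using lenv[OF u(1)] by (simp add: X_def Y_def)
  have gramv: "X v \<bullet> X w = Y v \<bullet> Y w" if "w \<in> N" for w
    using inner_polarization[of "X v" "X w"] inner_polarization[of "Y v" "Y w"] lenv[OF that] selfv
      self[OF subsetD[OF N(1) that]] by simp
  have tN: "t i \<in> N" "t i \<in> V - {v}" for i using t(2) N(1) by auto
  have "norm (p v - p w) = norm (q v - q w)" if w: "w \<in> V - {v}" for w
  proof -
    have "\<exists>\<kappa>. X w = (\<Sum>i\<in>UNIV. \<kappa> i *\<^sub>R X (t i))"
      unfolding X_def using N(1) u t
      by (intro independent_family_span generic_simplex_independent[OF p _ t(1)]) auto
    then obtain \<kappa> where \<kappa>: "X w = (\<Sum>i\<in>UNIV. \<kappa> i *\<^sub>R X (t i))" ..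
    define K where "K = (\<Sum>i\<in>UNIV. \<kappa> i *\<^sub>R Y (t i))"
    have 1: "Y w \<bullet> K = X w \<bullet> X w"
      by (subst (2) \<kappa>) (simp add: K_def inner_sum_right gram[OF w tN(2)])
    have 2: "K \<bullet> K = X w \<bullet> X w"
      unfolding \<kappa> by (simp add: K_def inner_sum_right inner_sum_left gram[OF tN(2) tN(2)])
    have "(Y w - K) \<bullet> (Y w - K) = 0"
      using 1 2 self[OF w] by (simp add: inner_diff_left inner_diff_right inner_commute)
    then have K: "Y w = K" by simp
    have "X v \<bullet> X w = Y v \<bullet> Y w"
      unfolding K by (simp add: \<kappa> K_def inner_sum_right gramv[OF tN(1)])
    then have "(X v - X w) \<bullet> (X v - X w) = (Y v - Y w) \<bullet> (Y v - Y w)"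
      using selfv self[OF w] by (simp add: inner_diff_left inner_diff_right inner_commute)
    then show ?thesis by (simp add: X_def Y_def sq)
  qed
  then show ?thesis
    using cong unfolding congruent_fw_def by (metis Diff_iff cancel_comm_monoid_add_class.diff_cancel
        norm_minus_commute singletonD)
qed

text \<open>Deleting a neighbour of \<open>v\<close> leaves \<open>v\<close> not joined to
  \<open>w\<close>, so at least d neighbours survive and there were d + 1. If \<open>v\<close> has
  no neighbours, deleting a third vertex is contradictory, and two vertices without an edge are
  excluded by \<open>nontrivial\<close>.\<close>

lemma infinitesimally_rigid_deletions_degree:
  fixes p :: "'a \<Rightarrow> real ^ 'd::finite"
  assumes G: "simple_graph V E" and nontrivial: "\<not> (card V = 2 \<and> E = {})" and p: "generic V p"
    and rigid: "\<And>v. v \<in> V \<Longrightarrow> infinitesimally_rigid (V - {v}) (del_edges E v) p"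
    and vw: "v \<in> V" "w \<in> V" "v \<noteq> w" "{v, w} \<notin> E"
  shows "CARD('d) < card (neighbours E v)"
proof -
  have del: "CARD('d) \<le> card (neighbours E v - {z})" if z: "z \<in> V" "z \<noteq> v" "z \<noteq> w" for z
  proof -
    have "CARD('d) \<le> card (neighbours (del_edges E z) v)"
      using infinitesimally_rigid_degree[OF simple_graph_del[OF G] generic_subset[OF p] rigid[OF z(1)], of v w] vw z
      by (auto simp: del_edges_def)
    then show ?thesis using z(2) by (simp add: neighbours_del)
  qed
  have N: "finite (neighbours E v)" "neighbours E v \<subseteq> V - {v}"
    using finite_neighbours[OF G] neighbours_subset[OF G] by auto
  have "CARD('d) > 0" by simp
  show ?thesis
  proof (cases "neighbours E v = {}")
    case False
    then obtain z where z: "z \<in> neighbours E v" by blast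
    then have "z \<in> V" "z \<noteq> v" "z \<noteq> w" using N(2) vw(4) by (auto simp: neighbours_def)
    from del[OF this] have "CARD('d) \<le> card (neighbours E v) - 1" using z by simp
    then show ?thesis using \<open>CARD('d) > 0\<close> by linarith
  next
    case True
    have "V = {v, w}"
    proof (rule ccontr)
      assume "V \<noteq> {v, w}"
      then obtain z where "z \<in> V" "z \<noteq> v" "z \<noteq> w" using vw by blast
      from del[OF this] True \<open>CARD('d) > 0\<close> show False by simp
    qed
    then have "E \<noteq> {}" using nontrivial vw(3) by auto
    then obtain e where "e \<in> E" by blast
    then have "e \<subseteq> {v, w}" "card e = 2" using G \<open>V = {v, w}\<close> by (auto simp: simple_graph_def)
    then have "e = {v, w}" using vw(3) by (intro card_subset_eq) auto
    then show ?thesis using \<open>e \<in> E\<close> vw(4) by simp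
  qed
qed

lemma equivalent_imp_congruent:
  fixes p q :: "'a \<Rightarrow> real ^ 'd::finite"
  assumes "simple_graph V E" "\<not> (card V = 2 \<and> E = {})" "generic V p"
    and "\<And>v. v \<in> V \<Longrightarrow> infinitesimally_rigid (V - {v}) (del_edges E v) p"
    and "\<And>e. e \<in> E \<Longrightarrow> bar e p p = bar e q q"
  shows "congruent_fw V p q"
  using assms
proof (induction "card V" arbitrary: V E rule: less_induct)
  case less
  note G = less.prems(1) and p = less.prems(3) and rigid = less.prems(4) and eq = less.prems(5)
  show ?case
  proof (cases "\<forall>v\<in>V. \<forall>w\<in>V. v \<noteq> w \<longrightarrow> {v, w} \<in> E")
    case True
    have "norm (p v - p w) = norm (q v - q w)" if "v \<in> V" "w \<in> V" for v w
      using True eq[of "{v, w}"] that by (cases "v = w") (auto simp: bar_pair_eq_iff)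
    then show ?thesis by (simp add: congruent_fw_def)
  next
    case False
    then obtain v w where vw: "v \<in> V" "w \<in> V" "v \<noteq> w" "{v, w} \<notin> E" by blast
    let ?N = "neighbours E v"
    have deg: "CARD('d) < card ?N"
      by (rule infinitesimally_rigid_deletions_degree[OF less.prems(1-4) vw])
    have N: "finite ?N" "?N \<subseteq> V - {v}" using finite_neighbours[OF G] neighbours_subset[OF G] by auto
    have cN: "norm (p a - p b) = norm (q a - q b)" if "a \<in> ?N" "b \<in> ?N" for a b
      by (rule neighbours_congruent[OF G p vw(1) rigid[OF vw(1)] eq deg that])
    define E' where "E' = del_edges E v \<union> clique ?N"
    have G': "simple_graph (V - {v}) E'"
      using simple_graph_del[OF G, of v] N(2) by (auto simp: simple_graph_def E'_def clique_def)
    have "congruent_fw (V - {v}) p q"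
    proof (rule less.hyps)
      show "card (V - {v}) < card V"
        using vw(1) simple_graphD(1)[OF G] by (rule card_Diff1_less[rotated])
      show "simple_graph (V - {v}) E'" by (rule G')
      show "generic (V - {v}) p" using generic_subset[OF p] by blast
      show "bar e p p = bar e q q" if "e \<in> E'" for e
        using that eq cN by (auto simp: E'_def del_edges_def clique_def bar_pair_eq_iff)
      \<comment> \<open>Since d is at least 1, the added clique has an edge, so the excluded case of
        two isolated vertices cannot arise in the induction.\<close>
      have "card ?N \<ge> 2" using deg zero_less_card_finite[where ?'a = 'd] by linarith
      then obtain a b where "a \<in> ?N" "b \<in> ?N" "a \<noteq> b"
        by (metis card_le_Suc0_iff_eq N(1) not_less_eq_eq numeral_2_eq_2)
      then have "{a, b} \<in> E'" by (auto simp: E'_def clique_def)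
      then show "\<not> (card (V - {v}) = 2 \<and> E' = {})" by blast
      fix u assume u: "u \<in> V - {v}"
      \<comment> \<open>Removing \<open>v\<close> with a clique on its neighbours commutes with
        deleting \<open>u\<close>, so the contraction is applied to the rigid graph obtained by
        deleting \<open>u\<close>.\<close>
      have "infinitesimally_rigid (V - {u} - {v})
          (del_edges (del_edges E u) v \<union> clique (neighbours (del_edges E u) v)) p"
        using u vw(1) generic_subset[OF p]
        by (intro infinitesimally_rigid_contract simple_graph_del[OF G] rigid) auto
      moreover have "del_edges (del_edges E u) v \<union> clique (neighbours (del_edges E u) v) = del_edges E' u"
      proof -
        have "neighbours (del_edges E u) v = ?N - {u}" using u by (intro neighbours_del) auto
        moreover have "clique (?N - {u}) = {e \<in> clique ?N. u \<notin> e}" by (auto simp: clique_def)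
        ultimately show ?thesis by (auto simp: E'_def del_edges_def)
      qed
      moreover have "V - {u} - {v} = V - {v} - {u}" by blast
      ultimately show "infinitesimally_rigid (V - {v} - {u}) (del_edges E' u) p" by simp
    qed
    moreover have "norm (p v - p w) = norm (q v - q w)" if "w \<in> ?N" for w
      using eq[of "{v, w}"] that by (simp add: neighbours_def bar_pair_eq_iff)
    ultimately show ?thesis using congruent_extend[OF p N(2) deg] by blast
  qed
qed

theorem theorem4p3:
  fixes V :: "'a set" and E :: "'a set set"
  assumes "simple_graph V E"
    and "\<not> (card V = 2 \<and> E = {})"
    and "vertex_redundantly_rigid TYPE('d::finite) V E"
  shows "globally_rigid_graph TYPE('d) V E"
proof -
  obtain p :: "'a \<Rightarrow> real ^ 'd" where p: "p \<in> realizations V" "generic V p"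
    using generic_exists simple_graphD(1)[OF assms(1)] by blast
  have rigid: "infinitesimally_rigid (V - {v}) (del_edges E v) p" if "v \<in> V" for v
    using assms(3) that generic_subset[OF p(2)]
    by (intro rigid_graph_imp_infinitesimally_rigid simple_graph_del[OF assms(1)])
      (auto simp: vertex_redundantly_rigid_def)
  have "congruent_fw V p q" if q: "equivalent_fw E p q" for q
  proof (rule equivalent_imp_congruent[OF assms(1,2) p(2) rigid])
    fix e assume e: "e \<in> E"
    then have "card e = 2" using assms(1) by (simp add: simple_graph_def)
    then obtain u w where "e = {u, w}" by (auto simp: card_2_iff)
    then show "bar e p p = bar e q q"
      using q e by (simp add: equivalent_fw_def bar_pair_eq_iff)
  qed
  then have "globally_rigid_fw V E p" by (simp add: globally_rigid_fw_def)
  then show ?thesis using p unfolding globally_rigid_graph_def by blast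
qed

end
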